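(* Consider a network (as described in the context) operated under a $w$-WMW policy, for some fixed $w\in\mathbb{R}_{++}^n$. There exists a constant $C$ (the sensitivity constant, depending only on the network and $w$) such that the following holds. Let $A:\mathbb{Z}_+\to\mathbb{R}_+^n$ be any arrival function and $Q(\cdot)$ a corresponding queue length process under the $w$-WMW policy. Let $\lambda\in\mathbb{R}^n$ with $\lambda\succeq 0$ (componentwise), and let $q(\cdot)$ be a fluid solution (for arrival rate $\lambda$ and weights $w$) with $q(0)=Q(0)$. Then for every $k\in\mathbb{Z}_+$, $$\|Q(k)-q(k)\|_2\le C\left(1+\|\lambda\|+\max_{t<k}\Big\|\sum_{\tau=0}^{t}\big(A(\tau)-\lambda\big)\Big\|_2\right).$$
   Context: A network consists of $n$ queues, a routing matrix $R\in\mathbb{R}^{n\times n}$ with nonnegative entries, and a finite set $\mathcal{S}\subset\mathbb{R}_+^n$ of service vectors. Standing assumption: for every $\mu\in\mathcal{S}$ and every $i\in\{1,\dots,n\}$, the vector obtained from $\mu$ by setting its $i$-th entry to zero also belongs to $\mathcal{S}$. Given an arrival function $A:\mathbb{Z}_+\to\mathbb{R}_+^n$, a queue length process $Q:\mathbb{Z}_+\to\mathbb{R}_+^n$ (with $Q(0)\in\mathbb{R}_+^n$) evolves by $Q(t+1)=Q(t)+A(t)+(R-I)\min(\mu(t),Q(t))$, where $\min$ is componentwise and $\mu(t)\in\mathcal{S}$ is the service vector chosen at time $t$. For $w\in\mathbb{R}_{++}^n$ let $W=\mathrm{diag}(w)$ and $\mathcal{S}_w(x)=\arg\max_{\mu\in\mathcal{S}}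 x^TW(I-R)\mu$. Under the $w$-WMW (weighted max-weight) policy, $\mu(t)$ is an arbitrary element of $\mathcal{S}_w(Q(t))$; the MW policy is the case $w=(1,\dots,1)$. Fluid solution: given $\lambda\in\mathbb{R}_+^n$ and weights $w$, an absolutely continuous $q:\mathbb{R}_+\to\mathbb{R}_+^n$ for which there exist functions $s_\mu:\mathbb{R}_+\to[0,1]$ ($\mu\in\mathcal{S}$) and $y:\mathbb{R}_+\to\mathbb{R}_+^n$ such that for almost every $t$: $\dot q(t)=\lambda+(R-I)\big(\sum_{\mu\in\mathcal{S}}s_\mu(t)\mu-y(t)\big)$; $\sum_{\mu}s_\mu(t)=1$; $y_i(t)\le\sum_\mu s_\mu(t)\mu_i$ for all $i$; if $q_i(t)>0$ then $y_i(t)=0$; and if $\mu\notin\mathcal{S}_w(q(t))$ then $s_\mu(t)=0$. The maximum over $t<k$ is taken over integers $0\le t<k$ (and is $0$ when $k=0$). *)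

theory Defs
  imports "HOL-Analysis.Analysis"
begin

definition diagm :: "real^'n \<Rightarrow> real^'n^'n" where
  "diagm w = (\<chi> i j. if i = j then w $ i else 0)"

definition vmin :: "real^'n \<Rightarrow> real^'n \<Rightarrow> real^'n" where
  "vmin x y = (\<chi> i. min (x $ i) (y $ i))"

definition nonneg_vec :: "real^'n \<Rightarrow> bool" where
  "nonneg_vec x \<longleftrightarrow> (\<forall>i. 0 \<le> x $ i)"

definition pos_vec :: "real^'n \<Rightarrow> bool" where
  "pos_vec x \<longleftrightarrow> (\<forall>i. 0 < x $ i)"

definition network :: "real^'n^'n \<Rightarrow> (real^'n) set \<Rightarrow> bool" where
  "network R S \<longleftrightarrow> (\<forall>i j. 0 \<le> R $ i $ j) \<and> finite S \<and> (\<forall>\<mu>\<in>S. nonneg_vec \<mu>) \<and>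
     (\<forall>\<mu>\<in>S. \<forall>i. (\<chi> j. if j = i then 0 else \<mu> $ j) \<in> S)"

definition Sw :: "real^'n^'n \<Rightarrow> (real^'n) set \<Rightarrow> real^'n \<Rightarrow> real^'n \<Rightarrow> (real^'n) set" where
  "Sw R S w x = {\<mu> \<in> S. \<forall>\<nu>\<in>S.
      x \<bullet> (diagm w *v ((mat 1 - R) *v \<nu>)) \<le> x \<bullet> (diagm w *v ((mat 1 - R) *v \<mu>))}"

definition wmw_process ::
  "real^'n^'n \<Rightarrow> (real^'n) set \<Rightarrow> real^'n \<Rightarrow> (nat \<Rightarrow> real^'n) \<Rightarrow> (nat \<Rightarrow> real^'n) \<Rightarrow> bool" where
  "wmw_process R S w A Q \<longleftrightarrow> nonneg_vec (Q 0) \<and>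
     (\<exists>\<mu>::nat \<Rightarrow> real^'n. \<forall>t. \<mu> t \<in> Sw R S w (Q t) \<and>
        Q (Suc t) = Q t + A t + (R - mat 1) *v vmin (\<mu> t) (Q t))"

definition abs_cont_on :: "(real \<Rightarrow> 'a::real_normed_vector) \<Rightarrow> real set \<Rightarrow> bool" where
  "abs_cont_on f I \<longleftrightarrow> (\<forall>e>0. \<exists>d>0. \<forall>(m::nat) a b.
     (\<forall>k<m. a k \<in> I \<and> b k \<in> I \<and> a k \<le> b k) \<and>
     (\<forall>k<m. \<forall>l<m. k \<noteq> l \<longrightarrow> b k \<le> a l \<or> b l \<le> a k) \<and>
     (\<Sum>k<m. b k - a k) < d \<longrightarrow> (\<Sum>k<m. norm (f (b k) - f (a k))) < e)"

definition fluid_solution ::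
  "real^'n^'n \<Rightarrow> (real^'n) set \<Rightarrow> real^'n \<Rightarrow> real^'n \<Rightarrow> (real \<Rightarrow> real^'n) \<Rightarrow> bool" where
  "fluid_solution R S w lam q \<longleftrightarrow>
     (\<forall>T\<ge>0. abs_cont_on q {0..T}) \<and> (\<forall>t\<ge>0. nonneg_vec (q t)) \<and>
     (\<exists>(s::real^'n \<Rightarrow> real \<Rightarrow> real) (y::real \<Rightarrow> real^'n).
        (\<forall>\<mu>\<in>S. \<forall>t\<ge>0. 0 \<le> s \<mu> t \<and> s \<mu> t \<le> 1) \<and> (\<forall>t\<ge>0. nonneg_vec (y t)) \<and>
        (AE t in lborel. 0 \<le> t \<longrightarrow>
           (q has_vector_derivative
              (lam + (R - mat 1) *v ((\<Sum>\<mu>\<in>S. s \<mu> t *\<^sub>R \<mu>) - y t))) (at t within {0..}) \<and>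
           (\<Sum>\<mu>\<in>S. s \<mu> t) = 1 \<and>
           (\<forall>i. y t $ i \<le> (\<Sum>\<mu>\<in>S. s \<mu> t * \<mu> $ i)) \<and>
           (\<forall>i. q t $ i > 0 \<longrightarrow> y t $ i = 0) \<and>
           (\<forall>\<mu>\<in>S. \<mu> \<notin> Sw R S w (q t) \<longrightarrow> s \<mu> t = 0)))"

definition max_below :: "nat \<Rightarrow> (nat \<Rightarrow> real) \<Rightarrow> real" where
  "max_below k f = (if k = 0 then 0 else Max (f ` {..<k}))"

end

theory Submission
  imports Defs
begin

text \<open>
  In the coordinates \<open>diag(sqrt w) x\<close> the drift of both processes is the rate \<open>\<lambda>\<close> minus a (near-)subgradient
  of the polyhedral function \<open>\<Phi>(z) = Max {z \<bullet> \<nu>\<^sub>\<mu> | \<mu> \<in> S}\<close>, where \<open>\<nu>\<^sub>\<mu> = diag(sqrt w) (I - R) \<mu>\<close>.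
  The truncation \<open>min(\<mu>, Q)\<close> and the idling term \<open>y\<close> do not spoil this, because zeroing the entry of an
  (almost) empty queue keeps a service vector (almost) maximal. After the accumulated arrival fluctuations
  are subtracted from \<open>Q\<close>, the difference \<open>v\<close> of the two trajectories moves along
  \<open>\<nu>\<^sub>\<kappa> - \<nu>\<^sub>\<mu>\<close> only if \<open>d = \<nu>\<^sub>\<mu> - \<nu>\<^sub>\<kappa>\<close> satisfies \<open>v \<bullet> d \<ge> - \<epsilon>\<close>, where \<open>\<epsilon>\<close> is of the order of the
  fluctuations; \<open>\<lambda>\<close> cancels.

  The squared norm of \<open>v\<close> could therefore still grow at rate \<open>\<epsilon>\<close>. Instead consider
  \<open>Max {|P\<^sub>E v|\<^sup>2 + c(|E|) | E \<subseteq> D}\<close>, where \<open>D\<close> is the finite set of all differences \<open>d\<close>, \<open>P\<^sub>E\<close> is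
  the orthogonal projection along \<open>span E\<close>, and the levels \<open>c(k)\<close>, multiples of \<open>\<epsilon>\<^sup>2\<close>, increase fast enough.
  Whenever the maximum is attained at \<open>E\<close>, every \<open>d\<close> with \<open>v \<bullet> d \<ge> - \<epsilon>\<close> has \<open>P\<^sub>E v \<bullet> d \<ge> 0\<close>. So this
  function does not increase along \<open>v\<close>. It starts at a multiple of \<open>\<epsilon>\<^sup>2\<close> and dominates \<open>|v|\<^sup>2\<close>.
\<close>

section \<open>Absolutely continuous functions\<close>

definition disjoint_intervals_in :: "real set \<Rightarrow> 'k set \<Rightarrow> ('k \<Rightarrow> real) \<Rightarrow> ('k \<Rightarrow> real) \<Rightarrow> bool" where
  "disjoint_intervals_in I P l r \<longleftrightarrow> finite P \<and> (\<forall>k\<in>P. l k \<in> I \<and> r k \<in> I \<and> l k \<le> r k) \<and>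
     (\<forall>j\<in>P. \<forall>k\<in>P. j \<noteq> k \<longrightarrow> r j \<le> l k \<or> r k \<le> l j)"

text \<open>The family is transported along a bijection with an initial segment of the naturals. A
  free index type lets the tagged intervals of a division, or a single interval over
  \<open>unit\<close>, serve directly as the family.\<close>

lemma abs_cont_onD:
  assumes ac: "abs_cont_on f I" and "0 < e"
  shows "\<exists>d>0. \<forall>(P::'k set) l r. disjoint_intervals_in I P l r \<and> (\<Sum>k\<in>P. r k - l k) < d \<longrightarrow>
    (\<Sum>k\<in>P. norm (f (r k) - f (l k))) < e"
proof -
  have "\<exists>d>0. \<forall>(m::nat) a b.
     (\<forall>k<m. a k \<in> I \<and> b k \<in> I \<and> a k \<le> b k) \<and>
     (\<forall>k<m. \<forall>l<m. k \<noteq> l \<longrightarrow> b k \<le> a l \<or> b l \<le> a k) \<and>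
     (\<Sum>k<m. b k - a k) < d \<longrightarrow> (\<Sum>k<m. norm (f (b k) - f (a k))) < e"
    using assms unfolding abs_cont_on_def by simp
  then obtain d where "0 < d" and d: "\<forall>(m::nat) a b.
     (\<forall>k<m. a k \<in> I \<and> b k \<in> I \<and> a k \<le> b k) \<and>
     (\<forall>k<m. \<forall>l<m. k \<noteq> l \<longrightarrow> b k \<le> a l \<or> b l \<le> a k) \<and>
     (\<Sum>k<m. b k - a k) < d \<longrightarrow> (\<Sum>k<m. norm (f (b k) - f (a k))) < e"
    by (elim exE conjE) (rule that)
  show ?thesis
  proof (intro exI[of _ d] conjI allI impI, fact)
    fix P :: "'k set" and l r :: "'k \<Rightarrow> real"
    assume *: "disjoint_intervals_in I P l r \<and> (\<Sum>k\<in>P. r k - l k) < d"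
    then have "finite P"
      by (simp add: disjoint_intervals_in_def)
    then obtain h where h: "bij_betw h {..<card P} P"
      using ex_bij_betw_nat_finite by (metis atLeast0LessThan)
    have hP: "h k \<in> P" if "k < card P" for k
      using h that by (auto simp: bij_betw_def)
    have hne: "h j \<noteq> h k" if "j < card P" "k < card P" "j \<noteq> k" for j k
      using h that by (auto simp: bij_betw_def inj_on_def)
    have "(\<Sum>k<card P. norm (f (r (h k)) - f (l (h k)))) < e"
    proof (rule d[THEN spec, THEN spec, THEN spec, THEN mp], intro conjI)
      show "(\<Sum>k<card P. r (h k) - l (h k)) < d"
        using * sum.reindex_bij_betw[OF h, of "\<lambda>k. r k - l k"] by simp
    qed (use * hP hne in \<open>simp_all add: disjoint_intervals_in_def\<close>)
    then show "(\<Sum>k\<in>P. norm (f (r k) - f (l k))) < e"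
      using sum.reindex_bij_betw[OF h, of "\<lambda>k. norm (f (r k) - f (l k))"] by simp
  qed
qed

lemma abs_cont_onI:
  assumes "\<And>e. 0 < e \<Longrightarrow> \<exists>d>0. \<forall>(P::nat set) l r. disjoint_intervals_in I P l r \<and> (\<Sum>k\<in>P. r k - l k) < d \<longrightarrow>
    (\<Sum>k\<in>P. norm (f (r k) - f (l k))) < e"
  shows "abs_cont_on f I"
  unfolding abs_cont_on_def
proof (intro allI impI)
  fix e :: real assume "0 < e"
  from assms[OF this] obtain d where "0 < d"
    and d: "\<forall>(P::nat set) l r. disjoint_intervals_in I P l r \<and> (\<Sum>k\<in>P. r k - l k) < d \<longrightarrow>
      (\<Sum>k\<in>P. norm (f (r k) - f (l k))) < e"
    by (elim exE conjE) (rule that)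
  show "\<exists>d>0. \<forall>(m::nat) a b.
     (\<forall>k<m. a k \<in> I \<and> b k \<in> I \<and> a k \<le> b k) \<and>
     (\<forall>k<m. \<forall>l<m. k \<noteq> l \<longrightarrow> b k \<le> a l \<or> b l \<le> a k) \<and>
     (\<Sum>k<m. b k - a k) < d \<longrightarrow> (\<Sum>k<m. norm (f (b k) - f (a k))) < e"
  proof (intro exI[of _ d] conjI allI impI, fact)
    fix m :: nat and a b :: "nat \<Rightarrow> real"
    assume "(\<forall>k<m. a k \<in> I \<and> b k \<in> I \<and> a k \<le> b k) \<and>
       (\<forall>k<m. \<forall>l<m. k \<noteq> l \<longrightarrow> b k \<le> a l \<or> b l \<le> a k) \<and> (\<Sum>k<m. b k - a k) < d"
    then show "(\<Sum>k<m. norm (f (b k) - f (a k))) < e"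
      by (intro d[THEN spec, THEN spec, THEN spec, THEN mp]) (simp add: disjoint_intervals_in_def)
  qed
qed

text \<open>Covers both composition with a Lipschitz map (term \<open>B\<close>) and addition of an
  affine motion (term \<open>B'\<close>); each error term receives half of \<open>e\<close>.\<close>

lemma abs_cont_on_dominated:
  assumes ac: "abs_cont_on f I" and "0 \<le> B" "0 \<le> B'"
    and le: "\<And>x y. x \<in> I \<Longrightarrow> y \<in> I \<Longrightarrow> norm (g y - g x) \<le> B * norm (f y - f x) + B' * \<bar>y - x\<bar>"
  shows "abs_cont_on g I"
proof (rule abs_cont_onI)
  fix e :: real assume "0 < e"
  define e1 where "e1 = e / (2 * (B + 1))"
  have e1: "0 < e1" "B * e1 < e / 2"
    using \<open>0 < e\<close> \<open>0 \<le> B\<close> by (auto simp: e1_def field_simps)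
  from abs_cont_onD[OF ac \<open>0 < e1\<close>] obtain d where "0 < d"
    and d: "\<forall>(P::nat set) l r. disjoint_intervals_in I P l r \<and> (\<Sum>k\<in>P. r k - l k) < d \<longrightarrow>
      (\<Sum>k\<in>P. norm (f (r k) - f (l k))) < e1"
    by (elim exE conjE) (rule that)
  define d1 where "d1 = min d (e / (2 * (B' + 1)))"
  have d1: "0 < d1" "d1 \<le> d" "B' * d1 \<le> e / 2"
  proof -
    show "0 < d1" "d1 \<le> d"
      using \<open>0 < d\<close> \<open>0 < e\<close> \<open>0 \<le> B'\<close> by (auto simp: d1_def)
    have "B' * d1 \<le> B' * (e / (2 * (B' + 1)))"
      using \<open>0 \<le> B'\<close> by (intro mult_left_mono) (auto simp: d1_def)
    also have "\<dots> \<le> e / 2"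
      using \<open>0 < e\<close> \<open>0 \<le> B'\<close> by (auto simp: field_simps)
    finally show "B' * d1 \<le> e / 2" .
  qed
  show "\<exists>d>0. \<forall>(P::nat set) l r. disjoint_intervals_in I P l r \<and> (\<Sum>k\<in>P. r k - l k) < d \<longrightarrow>
    (\<Sum>k\<in>P. norm (g (r k) - g (l k))) < e"
  proof (intro exI[of _ d1] conjI allI impI, fact)
    fix P :: "nat set" and l r :: "nat \<Rightarrow> real"
    assume *: "disjoint_intervals_in I P l r \<and> (\<Sum>k\<in>P. r k - l k) < d1"
    have "(\<Sum>k\<in>P. norm (g (r k) - g (l k))) \<le> (\<Sum>k\<in>P. B * norm (f (r k) - f (l k)) + B' * (r k - l k))"
    proof (rule sum_mono)
      fix k assume "k \<in> P"
      then have "l k \<in> I" "r k \<in> I" "l k \<le> r k"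
        using * by (auto simp: disjoint_intervals_in_def)
      then show "norm (g (r k) - g (l k)) \<le> B * norm (f (r k) - f (l k)) + B' * (r k - l k)"
        using le[of "l k" "r k"] by simp
    qed
    also have "\<dots> = B * (\<Sum>k\<in>P. norm (f (r k) - f (l k))) + B' * (\<Sum>k\<in>P. r k - l k)"
      by (simp add: sum.distrib sum_distrib_left)
    also have "\<dots> \<le> B * e1 + B' * d1"
    proof -
      have "(\<Sum>k\<in>P. norm (f (r k) - f (l k))) < e1"
        by (rule d[THEN spec, THEN spec, THEN spec, THEN mp]) (use * d1(2) in simp)
      then show ?thesis
        using * assms(2,3) by (intro add_mono mult_left_mono) auto
    qed
    also have "\<dots> < e"
      using e1 d1 by linarith
    finally show "(\<Sum>k\<in>P. norm (g (r k) - g (l k))) < e" .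
  qed
qed

lemma abs_cont_on_subset:
  assumes ac: "abs_cont_on f I" and "J \<subseteq> I"
  shows "abs_cont_on f J"
proof (rule abs_cont_onI)
  fix e :: real assume "0 < e"
  from abs_cont_onD[OF ac this] obtain d where "0 < d"
    and d: "\<forall>(P::nat set) l r. disjoint_intervals_in I P l r \<and> (\<Sum>k\<in>P. r k - l k) < d \<longrightarrow>
      (\<Sum>k\<in>P. norm (f (r k) - f (l k))) < e"
    by (elim exE conjE) (rule that)
  have sub: "disjoint_intervals_in I P l r" if "disjoint_intervals_in J P l r" for P l and r :: "nat \<Rightarrow> real"
    using that \<open>J \<subseteq> I\<close> by (auto simp: disjoint_intervals_in_def)
  show "\<exists>d>0. \<forall>(P::nat set) l r. disjoint_intervals_in J P l r \<and> (\<Sum>k\<in>P. r k - l k) < d \<longrightarrow>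
      (\<Sum>k\<in>P. norm (f (r k) - f (l k))) < e"
  proof (intro exI[of _ d] conjI allI impI, fact)
    fix P :: "nat set" and l r :: "nat \<Rightarrow> real"
    assume "disjoint_intervals_in J P l r \<and> (\<Sum>k\<in>P. r k - l k) < d"
    then show "(\<Sum>k\<in>P. norm (f (r k) - f (l k))) < e"
      by (intro d[THEN spec, THEN spec, THEN spec, THEN mp]) (simp add: sub)
  qed
qed

lemma abs_cont_on_imp_continuous_on:
  assumes ac: "abs_cont_on f I"
  shows "continuous_on I f"
proof (subst continuous_on_iff, intro ballI allI impI)
  fix x and e :: real assume "x \<in> I" "0 < e"
  from abs_cont_onD[OF ac \<open>0 < e\<close>] obtain d where "0 < d"
    and d: "\<forall>(P::unit set) l r. disjoint_intervals_in I P l r \<and> (\<Sum>k\<in>P. r k - l k) < d \<longrightarrow>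
      (\<Sum>k\<in>P. norm (f (r k) - f (l k))) < e"
    by (elim exE conjE) (rule that)
  have "dist (f y) (f x) < e" if "y \<in> I" "dist y x < d" for y
  proof -
    have "norm (f (max x y) - f (min x y)) < e"
      using d[THEN spec, THEN spec, THEN spec, of "{()}" "\<lambda>_. min x y" "\<lambda>_. max x y"] that \<open>x \<in> I\<close>
      by (auto simp: disjoint_intervals_in_def dist_real_def min_def max_def split: if_splits)
    then show ?thesis
      by (auto simp: dist_norm max_def min_def norm_minus_commute split: if_splits)
  qed
  then show "\<exists>d>0. \<forall>x'\<in>I. dist x' x < d \<longrightarrow> dist (f x') (f x) < e"
    using \<open>0 < d\<close> by blast
qed

section \<open>Monotonicity from a local bound almost everywhere\<close>

lemma negligible_outer_open:
  fixes N :: "'a::euclidean_space set"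
  assumes "negligible N" "0 < e"
  obtains U where "open U" "N \<subseteq> U" "U \<in> lmeasurable" "measure lebesgue U < e"
proof -
  have N: "N \<in> null_sets lebesgue"
    using assms by (simp add: negligible_iff_null_sets)
  then obtain U where U: "open U" "N \<subseteq> U" "U - N \<in> lmeasurable" "emeasure lebesgue (U - N) < ennreal e"
    using sets_lebesgue_outer_open[of N e] \<open>0 < e\<close> null_setsD2[OF N] by blast
  have eq: "U = (U - N) \<union> N"
    using U by auto
  have e: "emeasure lebesgue U = emeasure lebesgue (U - N)"
    by (subst eq, rule emeasure_Un_null_set) (use U N in auto)
  then have less: "emeasure lebesgue U < ennreal e"
    using U(4) by simp
  have lm: "U \<in> lmeasurable"
  proof (rule fmeasurableI)
    show "U \<in> sets lebesgue" using borel_open[OF U(1)] by simp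
    show "emeasure lebesgue U < \<infinity>" using less by (rule order_less_trans) simp
  qed
  have "measure lebesgue U < e"
    using less emeasure_eq_measure2[OF lm] by (simp add: ennreal_less_iff)
  with lm show thesis
    using U that by blast
qed

text \<open>The increment of \<open>G\<close> is telescoped over a fine tagged division. Intervals
  tagged outside \<open>N\<close> are controlled by \<open>loc\<close>; those tagged in
  \<open>N\<close> have small total length and are controlled by absolute continuity. The bound in
  \<open>loc\<close> straddles \<open>t\<close> instead of using a derivative, because a maximum of
  smooth functions can have kinks.\<close>

lemma abs_cont_on_nonincreasing:
  fixes G :: "real \<Rightarrow> real"
  assumes ac: "abs_cont_on G {a..b}" and "a \<le> b" and N: "negligible N"
    and loc: "\<And>t e. \<lbrakk>t \<in> {a..b} - N; 0 < e\<rbrakk> \<Longrightarrow>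
      \<exists>d>0. \<forall>u v. a \<le> u \<and> u \<le> t \<and> t \<le> v \<and> v \<le> b \<and> t - u < d \<and> v - t < d \<longrightarrow> G v - G u \<le> e * (v - u)"
  shows "G b \<le> G a"
proof (rule field_le_epsilon)
  fix e' :: real assume "0 < e'"
  \<comment> \<open>Tags outside \<open>N\<close> will cost \<open>e * (b - a)\<close> in total,
    tags in \<open>N\<close> a further \<open>e\<close>.\<close>
  define e where "e = e' / (b - a + 1)"
  have "0 < e" using \<open>0 < e'\<close> \<open>a \<le> b\<close> by (simp add: e_def)
  from abs_cont_onD[OF ac \<open>0 < e\<close>] obtain \<delta> where "0 < \<delta>"
    and \<delta>: "\<forall>(P::(real \<times> real set) set) l r.
      disjoint_intervals_in {a..b} P l r \<and> (\<Sum>k\<in>P. r k - l k) < \<delta> \<longrightarrow>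
      (\<Sum>k\<in>P. norm (G (r k) - G (l k))) < e"
    by (elim exE conjE) (rule that)
  obtain U where U: "open U" "N \<subseteq> U" "U \<in> lmeasurable" "measure lebesgue U < \<delta>"
    using negligible_outer_open[OF N \<open>0 < \<delta>\<close>] .
  from loc[OF _ \<open>0 < e\<close>] have "\<forall>t\<in>{a..b} - N. \<exists>d>0. \<forall>u v. a \<le> u \<and> u \<le> t \<and> t \<le> v \<and> v \<le> b \<and>
      t - u < d \<and> v - t < d \<longrightarrow> G v - G u \<le> e * (v - u)" ..
  from bchoice[OF this] obtain d where d: "\<forall>t\<in>{a..b} - N. 0 < d t \<and> (\<forall>u v. a \<le> u \<and> u \<le> t \<and> t \<le> v \<and> v \<le> b \<and>
      t - u < d t \<and> v - t < d t \<longrightarrow> G v - G u \<le> e * (v - u))" ..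
  \<comment> \<open>Tags in \<open>N\<close> force their interval into the small open set
    \<open>U\<close>; the value \<open>UNIV\<close> only concerns points outside
    \<open>{a..b}\<close>, which are never tags.\<close>
  define \<gamma> where "\<gamma> t = (if t \<in> {a..b} - N then ball t (d t) else if t \<in> N then U else UNIV)" for t
  have "gauge \<gamma>"
    using U d by (simp add: gauge_def \<gamma>_def subset_iff)
  then obtain p where p: "p tagged_division_of {a..b}" "\<gamma> fine p"
    using fine_division_exists_real by blast
  have fin: "finite p"
    using p(1) by (rule tagged_division_of_finite)
  have pK: "\<exists>l r. K = {l..r} \<and> a \<le> l \<and> l \<le> x \<and> x \<le> r \<and> r \<le> b" if xK: "(x, K) \<in> p" for x K
  proof -
    obtain l r where "K = cbox l r"
      using tagged_division_ofD(4)[OF p(1) xK] by blast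
    moreover have "x \<in> K" "K \<subseteq> {a..b}"
      using tagged_division_ofD(2,3)[OF p(1) xK] by auto
    ultimately show ?thesis
      by (intro exI[of _ l] exI[of _ r]) auto
  qed
  define D where "D k = G (Sup (snd k)) - G (Inf (snd k))" for k :: "real \<times> real set"
  \<comment> \<open>Degenerate intervals contribute nothing and are left out: their interiors are
    empty, so disjointness of interiors would not order them.\<close>
  define P where "P = {(x, K) \<in> p. x \<in> N \<and> Inf K < Sup K}"
  have "P \<subseteq> p" by (auto simp: P_def)
  then have finP: "finite P" using fin finite_subset by blast
  have Pform: "\<exists>l r. snd k = {l..r} \<and> a \<le> l \<and> l < r \<and> r \<le> b \<and> {l..r} \<subseteq> U" if "k \<in> P" for k
  proof -
    obtain x K where k: "k = (x, K)" "(x, K) \<in> p" "x \<in> N" "Inf K < Sup K"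
      using \<open>k \<in> P\<close> by (auto simp: P_def)
    obtain l r where lr: "K = {l..r}" "a \<le> l" "l \<le> x" "x \<le> r" "r \<le> b"
      using pK[OF k(2)] by blast
    have "K \<subseteq> \<gamma> x"
      using p(2) k(2) by (auto simp: fine_def)
    then show ?thesis
      using k lr by (auto simp: \<gamma>_def)
  qed
  have disj: "Sup (snd j) \<le> Inf (snd k) \<or> Sup (snd k) \<le> Inf (snd j)" if "j \<in> P" "k \<in> P" "j \<noteq> k" for j k
  proof -
    have "interior (snd j) \<inter> interior (snd k) = {}"
      using tagged_division_ofD(5)[OF p(1), of "fst j" "snd j" "fst k" "snd k"] that \<open>P \<subseteq> p\<close>
      by (auto simp: prod_eq_iff)
    moreover obtain l r where "snd j = {l..r}" "l < r"
      using Pform \<open>j \<in> P\<close> by blast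
    moreover obtain l' r' where "snd k = {l'..r'}" "l' < r'"
      using Pform \<open>k \<in> P\<close> by blast
    ultimately show ?thesis
      by (auto simp: not_le)
  qed
  have "(\<Sum>k\<in>P. D k) \<le> e"
  proof -
    \<comment> \<open>The intervals overlap only in endpoints and lie in \<open>U\<close>, so their
      total length is the measure of their union and stays below \<open>\<delta>\<close>.\<close>
    have "(\<Sum>k\<in>P. Sup (snd k) - Inf (snd k)) = (\<Sum>k\<in>P. measure lebesgue (snd k))"
      by (intro sum.cong refl) (use Pform in fastforce)
    also have "\<dots> = measure lebesgue (\<Union>(snd ` P))"
    proof (rule measure_negligible_finite_Union_image[symmetric, OF finP])
      show "snd k \<in> lmeasurable" if "k \<in> P" for k
        using Pform[OF that] by auto
      show "pairwise (\<lambda>j k. negligible (snd j \<inter> snd k)) P"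
      proof (rule pairwiseI)
        fix j k assume jk: "j \<in> P" "k \<in> P" "j \<noteq> k"
        obtain l r l' r' where eq: "snd j = {l..r}" "l < r" "snd k = {l'..r'}" "l' < r'"
          using Pform jk by meson
        then have "snd j \<inter> snd k \<subseteq> {l, l'}"
          using disj[OF jk] by auto
        then show "negligible (snd j \<inter> snd k)"
          by (meson finite.emptyI finite_insert negligible_finite negligible_subset)
      qed
    qed
    also have "\<dots> \<le> measure lebesgue U"
    proof (rule measure_mono_fmeasurable)
      show "\<Union>(snd ` P) \<subseteq> U"
        using Pform by fastforce
      show "\<Union>(snd ` P) \<in> sets lebesgue"
        using finP Pform by (intro sets.finite_Union) fastforce+
    qed (use U in auto)
    also have "\<dots> < \<delta>" by fact
    finally have "(\<Sum>k\<in>P. norm (G (Sup (snd k)) - G (Inf (snd k)))) < e"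
      using Pform finP disj
      by (intro \<delta>[THEN spec, THEN spec, THEN spec, THEN mp] conjI, unfold disjoint_intervals_in_def) fastforce+
    moreover have "(\<Sum>k\<in>P. D k) \<le> (\<Sum>k\<in>P. norm (G (Sup (snd k)) - G (Inf (snd k))))"
      by (intro sum_mono) (simp add: D_def)
    ultimately show ?thesis by linarith
  qed
  moreover have "(\<Sum>k\<in>p - P. D k) \<le> (\<Sum>k\<in>p - P. e * (Sup (snd k) - Inf (snd k)))"
  proof (rule sum_mono)
    fix k assume "k \<in> p - P"
    obtain x K where k: "k = (x, K)" by (cases k)
    have xK: "(x, K) \<in> p" "(x, K) \<notin> P" using \<open>k \<in> p - P\<close> k by auto
    obtain l r where lr: "K = {l..r}" "a \<le> l" "l \<le> x" "x \<le> r" "r \<le> b"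
      using pK[OF xK(1)] by blast
    show "D k \<le> e * (Sup (snd k) - Inf (snd k))"
    proof (cases "x \<in> N")
      case True
      then have "l = r" using xK lr by (auto simp: P_def)
      then show ?thesis using lr k by (simp add: D_def)
    next
      case False
      then have x: "x \<in> {a..b} - N" using lr by auto
      have "K \<subseteq> ball x (d x)"
        using fineD[OF p(2) xK(1)] x by (simp add: \<gamma>_def)
      moreover have "l \<in> K" "r \<in> K" using lr by auto
      ultimately have "x - l < d x" "r - x < d x"
        by (auto simp: subset_iff dist_real_def)
      then have "G r - G l \<le> e * (r - l)"
        using d[THEN bspec, OF x, THEN conjunct2, THEN spec, THEN spec, of l r] lr by simp
      then show ?thesis using lr k by (simp add: D_def)
    qed
  qed
  moreover have "(\<Sum>k\<in>p - P. e * (Sup (snd k) - Inf (snd k))) \<le> (\<Sum>k\<in>p. e * (Sup (snd k) - Inf (snd k)))"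
    using fin pK \<open>0 < e\<close> by (intro sum_mono2) fastforce+
  moreover have "(\<Sum>k\<in>p. e * (Sup (snd k) - Inf (snd k))) = e * (b - a)"
    using additive_tagged_division_1[OF \<open>a \<le> b\<close> p(1), of "\<lambda>x. x"]
    by (simp add: sum_distrib_left[symmetric] case_prod_unfold)
  moreover have "(\<Sum>k\<in>p. D k) = G b - G a"
    using additive_tagged_division_1[OF \<open>a \<le> b\<close> p(1), of G]
    by (simp add: D_def case_prod_unfold)
  moreover have "(\<Sum>k\<in>p. D k) = (\<Sum>k\<in>p - P. D k) + (\<Sum>k\<in>P. D k)"
    by (rule sum.subset_diff) (use \<open>P \<subseteq> p\<close> fin in auto)
  ultimately have "G b - G a \<le> e * (b - a) + e"
    by linarith
  also have "\<dots> = e * (b - a + 1)"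
    by (simp add: algebra_simps)
  also have "\<dots> = e'"
    using \<open>a \<le> b\<close> by (simp add: e_def)
  finally show "G b \<le> G a + e'" by linarith
qed

section \<open>A Lyapunov function built from projections\<close>

definition oproj :: "'a::euclidean_space set \<Rightarrow> 'a \<Rightarrow> 'a" where
  "oproj E v = (SOME z. v - z \<in> span E \<and> (\<forall>x\<in>span E. z \<bullet> x = 0))"

lemma
  shows diff_oproj_in_span: "v - oproj E v \<in> span E"
    and oproj_inner_span: "x \<in> span E \<Longrightarrow> oproj E v \<bullet> x = 0"
proof -
  obtain y z where "y \<in> span E" "\<And>x. x \<in> span E \<Longrightarrow> orthogonal z x" "v = y + z"
    using orthogonal_subspace_decomp_exists by blast
  then have "v - z \<in> span E \<and> (\<forall>x\<in>span E. z \<bullet> x = 0)"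
    by (simp add: orthogonal_def)
  then have *: "v - oproj E v \<in> span E \<and> (\<forall>x\<in>span E. oproj E v \<bullet> x = 0)"
    unfolding oproj_def by (rule someI)
  then show "v - oproj E v \<in> span E" by simp
  show "oproj E v \<bullet> x = 0" if "x \<in> span E"
    using * that by simp
qed

lemma oproj_unique:
  assumes "v - z \<in> span E" and orth: "\<And>x. x \<in> span E \<Longrightarrow> z \<bullet> x = 0"
  shows "oproj E v = z"
proof -
  have "(v - z) - (v - oproj E v) \<in> span E"
    by (intro span_diff assms(1) diff_oproj_in_span)
  then have "oproj E v - z \<in> span E" by simp
  then have "(oproj E v - z) \<bullet> (oproj E v - z) = 0"
    by (simp add: inner_diff_left orth oproj_inner_span del: inner_eq_zero_iff)
  then show ?thesis by simp
qed

lemma linear_oproj: "linear (oproj E)"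
proof (rule linearI)
  fix x y :: 'a and r :: real
  show "oproj E (x + y) = oproj E x + oproj E y"
    using span_add[OF diff_oproj_in_span[of x E] diff_oproj_in_span[of y E]]
    by (intro oproj_unique) (simp_all add: inner_add_left oproj_inner_span algebra_simps)
  show "oproj E (r *\<^sub>R x) = r *\<^sub>R oproj E x"
    using span_mul[OF diff_oproj_in_span[of x E], of r]
    by (intro oproj_unique) (simp_all add: oproj_inner_span algebra_simps)
qed

lemma oproj_empty [simp]: "oproj {} v = v"
  by (rule oproj_unique) (auto simp: span_zero)

lemma oproj_inner_oproj: "oproj E v \<bullet> oproj E x = oproj E v \<bullet> x"
  using oproj_inner_span[OF diff_oproj_in_span[of x E], of v] by (simp add: inner_diff_right)

lemma norm_oproj_pythagoras: "(norm v)\<^sup>2 = (norm (oproj E v))\<^sup>2 + (norm (v - oproj E v))\<^sup>2"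
  using oproj_inner_span[OF diff_oproj_in_span[of v E], of v]
  by (simp add: power2_norm_eq_inner inner_diff_left inner_diff_right inner_commute)

lemma norm_oproj_le: "norm (oproj E v) \<le> norm v"
  by (rule power2_le_imp_le) (simp_all add: norm_oproj_pythagoras[of v E])

text \<open>One Gram-Schmidt step: enlarging \<open>E\<close> by \<open>d\<close> removes from
  \<open>oproj E v\<close> its component along \<open>oproj E d\<close>, which is nonzero because
  \<open>d\<close> is outside the span.\<close>

lemma norm_oproj_insert:
  assumes "d \<notin> span E"
  shows "(norm (oproj E v))\<^sup>2 - (norm (oproj (insert d E) v))\<^sup>2 = (oproj E v \<bullet> d)\<^sup>2 / (norm (oproj E d))\<^sup>2"
proof -
  define p u where "p = oproj E v" and "u = oproj E d"
  define a where "a = (p \<bullet> u) / (u \<bullet> u)"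
  have du: "d - u \<in> span E"
    unfolding u_def by (rule diff_oproj_in_span)
  have "u \<noteq> 0"
    using du assms by auto
  have sub: "span E \<subseteq> span (insert d E)"
    by (intro span_mono) auto
  have "u = d - (d - u)" by simp
  then have u_in: "u \<in> span (insert d E)"
    using du sub by (metis insertI1 span_base span_diff subsetD)
  have "oproj (insert d E) v = p - a *\<^sub>R u"
  proof (rule oproj_unique)
    have "(v - p) + a *\<^sub>R u \<in> span (insert d E)"
      using sub diff_oproj_in_span[of v E] u_in unfolding p_def by (intro span_add span_mul) auto
    then show "v - (p - a *\<^sub>R u) \<in> span (insert d E)"
      by (simp add: algebra_simps)
    fix x assume "x \<in> span (insert d E)"
    then obtain k where k: "x - k *\<^sub>R d \<in> span E"
      using span_breakdown_eq by blast
    then have "(x - k *\<^sub>R d) + k *\<^sub>R (d - u) \<in> span E"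
      using du by (intro span_add span_mul)
    then have "x - k *\<^sub>R u \<in> span E"
      by (simp add: algebra_simps)
    then have "p \<bullet> (x - k *\<^sub>R u) = 0" "u \<bullet> (x - k *\<^sub>R u) = 0"
      by (simp_all add: p_def u_def oproj_inner_span)
    then show "(p - a *\<^sub>R u) \<bullet> x = 0"
      using \<open>u \<noteq> 0\<close> by (simp add: inner_diff_left inner_diff_right a_def)
  qed
  then have "(norm (oproj (insert d E) v))\<^sup>2 = (p - a *\<^sub>R u) \<bullet> (p - a *\<^sub>R u)"
    by (simp add: power2_norm_eq_inner)
  also have "\<dots> = p \<bullet> p - 2 * a * (p \<bullet> u) + a * a * (u \<bullet> u)"
    by (simp add: inner_diff_left inner_diff_right inner_commute[of u p] algebra_simps)
  also have "\<dots> = p \<bullet> p - (p \<bullet> u)\<^sup>2 / (u \<bullet> u)"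
    using \<open>u \<noteq> 0\<close> by (simp add: a_def field_simps power2_eq_square)
  finally show ?thesis
    using oproj_inner_oproj[of E v d] by (simp add: p_def u_def power2_norm_eq_inner)
qed

section \<open>The maximum of projected norms and its levels\<close>

definition lyap_piece :: "(nat \<Rightarrow> real) \<Rightarrow> 'a::euclidean_space set \<Rightarrow> 'a \<Rightarrow> real" where
  "lyap_piece c E v = (norm (oproj E v))\<^sup>2 + c (card E)"

definition lyap :: "(nat \<Rightarrow> real) \<Rightarrow> 'a::euclidean_space set \<Rightarrow> 'a \<Rightarrow> real" where
  "lyap c D v = Max ((\<lambda>E. lyap_piece c E v) ` Pow D)"

text \<open>The left side bounds the squared norm lost in passing from \<open>E\<close> to
  \<open>insert d E\<close> when \<open>oproj E v \<bullet> d\<close> has absolute value at most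
  \<open>\<epsilon> + sqrt (c (card E)) * norm d\<close>; the right side is the level
  gained.\<close>

definition level_gap :: "(nat \<Rightarrow> real) \<Rightarrow> real \<Rightarrow> 'a::euclidean_space set \<Rightarrow> bool" where
  "level_gap c \<epsilon> D \<longleftrightarrow> c 0 = 0 \<and> (\<forall>E\<subseteq>D. \<forall>d\<in>D. d \<notin> span E \<longrightarrow>
     (\<epsilon> + sqrt (c (card E)) * norm d)\<^sup>2 / (norm (oproj E d))\<^sup>2 < c (Suc (card E)) - c (card E))"

lemma lyap_piece_le: "finite D \<Longrightarrow> E \<subseteq> D \<Longrightarrow> lyap_piece c E v \<le> lyap c D v"
  unfolding lyap_def by (rule Max_ge) auto

lemma lyap_attained:
  assumes "finite D"
  obtains E where "E \<subseteq> D" "lyap c D v = lyap_piece c E v"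
proof -
  have "lyap c D v \<in> (\<lambda>E. lyap_piece c E v) ` Pow D"
    unfolding lyap_def using assms by (intro Max_in) auto
  then show thesis using that by auto
qed

text \<open>Let the piece \<open>E\<close> be active at \<open>v\<close>. Comparison with the piece \<open>{}\<close> bounds \<open>norm (v - oproj E v)\<close> by
  \<open>sqrt (c (card E))\<close>, so a negative \<open>oproj E v \<bullet> d\<close> would be small. Then replacing \<open>E\<close> by
  \<open>insert d E\<close> would lose less in the squared norm than the level gap gains.\<close>

lemma active_piece_inner_nonneg:
  assumes fin: "finite D" and gap: "level_gap c \<epsilon> D" and "E \<subseteq> D"
    and act: "lyap_piece c E v = lyap c D v"
    and "d \<in> D" "- \<epsilon> \<le> v \<bullet> d"
  shows "0 \<le> oproj E v \<bullet> d"
proof (rule ccontr)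
  assume "\<not> 0 \<le> oproj E v \<bullet> d"
  then have neg: "oproj E v \<bullet> d < 0" by simp
  then have "d \<notin> span E"
    using oproj_inner_span[of d E v] by force
  then have "d \<notin> E"
    using span_base by blast
  have finE: "finite E"
    using fin \<open>E \<subseteq> D\<close> by (rule rev_finite_subset)
  have "lyap_piece c {} v \<le> lyap_piece c E v"
    unfolding act by (rule lyap_piece_le) (use fin in auto)
  then have "(norm (v - oproj E v))\<^sup>2 \<le> c (card E)"
    using gap norm_oproj_pythagoras[of v E] by (simp add: lyap_piece_def level_gap_def)
  then have "norm (v - oproj E v) \<le> sqrt (c (card E))"
    by (rule real_le_rsqrt)
  then have "norm (v - oproj E v) * norm d \<le> sqrt (c (card E)) * norm d"
    by (rule mult_right_mono) simp
  moreover have "(v - oproj E v) \<bullet> d \<le> norm (v - oproj E v) * norm d"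
    by (rule norm_cauchy_schwarz)
  ultimately have "- (oproj E v \<bullet> d) \<le> \<epsilon> + sqrt (c (card E)) * norm d"
    using \<open>- \<epsilon> \<le> v \<bullet> d\<close> by (simp add: inner_diff_left)
  then have "(- (oproj E v \<bullet> d))\<^sup>2 \<le> (\<epsilon> + sqrt (c (card E)) * norm d)\<^sup>2"
    using neg by (intro power_mono) auto
  then have "(oproj E v \<bullet> d)\<^sup>2 / (norm (oproj E d))\<^sup>2
      \<le> (\<epsilon> + sqrt (c (card E)) * norm d)\<^sup>2 / (norm (oproj E d))\<^sup>2"
    by (intro divide_right_mono) auto
  also have "\<dots> < c (Suc (card E)) - c (card E)"
    using gap \<open>E \<subseteq> D\<close> \<open>d \<in> D\<close> \<open>d \<notin> span E\<close> by (simp add: level_gap_def)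
  finally have "lyap_piece c E v < lyap_piece c (insert d E) v"
    using norm_oproj_insert[OF \<open>d \<notin> span E\<close>, of v] finE \<open>d \<notin> E\<close> by (simp add: lyap_piece_def)
  also have "\<dots> \<le> lyap c D v"
    by (rule lyap_piece_le) (use fin \<open>E \<subseteq> D\<close> \<open>d \<in> D\<close> in auto)
  finally show False
    using act by simp
qed

text \<open>For levels proportional to \<open>\<epsilon>\<^sup>2\<close>, both sides of the gap
  condition scale by \<open>\<epsilon>\<^sup>2\<close>. A recursion for the case \<epsilon> = 1
  therefore serves every positive \<epsilon>, with \<open>\<gamma>\<close> depending on
  \<open>D\<close> alone; this makes the final constant independent of arrivals and rates.\<close>

lemma level_gap_exists:
  fixes D :: "'a::euclidean_space set"
  assumes fin: "finite D"
  obtains \<gamma> :: "nat \<Rightarrow> real" where "mono \<gamma>" "\<And>\<epsilon>. 0 < \<epsilon> \<Longrightarrow> level_gap (\<lambda>k. \<epsilon>\<^sup>2 * \<gamma> k) \<epsilon> D"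
proof -
  \<comment> \<open>\<open>K\<close> bounds all the reciprocals at once and \<open>m\<close> all the
    norms. A vanishing projection contributes 0, since division by zero yields 0. The summand 1 in
    the recursion makes the gap strict.\<close>
  define K where "K = (\<Sum>E\<in>Pow D. \<Sum>d\<in>D. 1 / (norm (oproj E d))\<^sup>2)"
  define m where "m = (\<Sum>d\<in>D. norm d)"
  define \<gamma> :: "nat \<Rightarrow> real" where "\<gamma> = rec_nat 0 (\<lambda>_ g. g + K * (1 + sqrt g * m)\<^sup>2 + 1)"
  have g0: "\<gamma> 0 = 0" and gS: "\<gamma> (Suc k) = \<gamma> k + K * (1 + sqrt (\<gamma> k) * m)\<^sup>2 + 1" for k
    by (simp_all add: \<gamma>_def)
  have "0 \<le> K"
    unfolding K_def by (intro sum_nonneg) auto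
  have "mono \<gamma>"
    unfolding mono_iff_le_Suc gS using \<open>0 \<le> K\<close> by simp
  have gpos: "0 \<le> \<gamma> k" for k
    using monoD[OF \<open>mono \<gamma>\<close>, of 0 k] g0 by simp
  have "level_gap (\<lambda>k. \<epsilon>\<^sup>2 * \<gamma> k) \<epsilon> D" if "0 < \<epsilon>" for \<epsilon>
    unfolding level_gap_def
  proof (intro conjI allI impI ballI)
    show "\<epsilon>\<^sup>2 * \<gamma> 0 = 0" by (simp add: g0)
    fix E d assume E: "E \<subseteq> D" and d: "d \<in> D"
    define g where "g = \<gamma> (card E)"
    have "1 / (norm (oproj E d))\<^sup>2 \<le> (\<Sum>d\<in>D. 1 / (norm (oproj E d))\<^sup>2)"
      using fin d by (intro member_le_sum) auto
    also have "\<dots> \<le> K"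
      unfolding K_def using fin E
      by (intro member_le_sum[of E "Pow D" "\<lambda>E. \<Sum>d\<in>D. 1 / (norm (oproj E d))\<^sup>2"] sum_nonneg) auto
    finally have 1: "1 / (norm (oproj E d))\<^sup>2 \<le> K" .
    have "norm d \<le> m"
      unfolding m_def using fin d by (intro member_le_sum) auto
    then have 2: "(1 + sqrt g * norm d)\<^sup>2 \<le> (1 + sqrt g * m)\<^sup>2"
      using gpos by (intro power_mono add_mono mult_left_mono) (auto simp: g_def)
    have "(\<epsilon> + sqrt (\<epsilon>\<^sup>2 * g) * norm d)\<^sup>2 / (norm (oproj E d))\<^sup>2
        = \<epsilon>\<^sup>2 * ((1 / (norm (oproj E d))\<^sup>2) * (1 + sqrt g * norm d)\<^sup>2)"
    proof -
      have "\<epsilon> + sqrt (\<epsilon>\<^sup>2 * g) * norm d = \<epsilon> * (1 + sqrt g * norm d)"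
        using \<open>0 < \<epsilon>\<close> by (simp add: real_sqrt_mult algebra_simps)
      then show ?thesis by (simp add: power_mult_distrib)
    qed
    also have "\<dots> \<le> \<epsilon>\<^sup>2 * (K * (1 + sqrt g * m)\<^sup>2)"
      using 1 2 \<open>0 \<le> K\<close> by (intro mult_left_mono mult_mono) auto
    also have "\<dots> < \<epsilon>\<^sup>2 * (K * (1 + sqrt g * m)\<^sup>2 + 1)"
      using \<open>0 < \<epsilon>\<close> by simp
    also have "\<dots> = \<epsilon>\<^sup>2 * \<gamma> (Suc (card E)) - \<epsilon>\<^sup>2 * \<gamma> (card E)"
      by (simp add: gS g_def algebra_simps)
    finally show "(\<epsilon> + sqrt (\<epsilon>\<^sup>2 * \<gamma> (card E)) * norm d)\<^sup>2 / (norm (oproj E d))\<^sup>2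
        < \<epsilon>\<^sup>2 * \<gamma> (Suc (card E)) - \<epsilon>\<^sup>2 * \<gamma> (card E)"
      by (simp add: g_def)
  qed
  with \<open>mono \<gamma>\<close> show thesis by (rule that)
qed

lemma norm_le_lyap: "finite D \<Longrightarrow> c 0 = 0 \<Longrightarrow> (norm v)\<^sup>2 \<le> lyap c D v"
  using lyap_piece_le[of D "{}" c v] by (simp add: lyap_piece_def)

lemma lyap_0_le:
  assumes "finite D" "mono c"
  shows "lyap c D 0 \<le> c (card D)"
proof -
  obtain E where E: "E \<subseteq> D" "lyap c D 0 = lyap_piece c E 0"
    using lyap_attained[OF assms(1)] .
  moreover have "c (card E) \<le> c (card D)"
    using assms E(1) by (intro monoD[OF assms(2)] card_mono)
  ultimately show ?thesis
    by (simp add: lyap_piece_def linear_0[OF linear_oproj])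
qed

section \<open>The Lyapunov function along an absolutely continuous curve\<close>

lemma lyap_lipschitz:
  assumes fin: "finite D" and "norm x \<le> B" "norm y \<le> B"
  shows "lyap c D x - lyap c D y \<le> 2 * B * norm (x - y)"
proof -
  obtain E where E: "E \<subseteq> D" "lyap c D x = lyap_piece c E x"
    using lyap_attained[OF fin] .
  \<comment> \<open>The piece attaining the maximum at \<open>x\<close> is still a lower bound for
    the maximum at \<open>y\<close>.\<close>
  have "lyap c D x - lyap c D y \<le> lyap_piece c E x - lyap_piece c E y"
    using E lyap_piece_le[OF fin E(1), of c y] by simp
  also have "\<dots> = (norm (oproj E x) + norm (oproj E y)) * (norm (oproj E x) - norm (oproj E y))"
    by (simp add: lyap_piece_def power2_eq_square algebra_simps)
  also have "\<dots> \<le> (2 * B) * norm (x - y)"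
  proof -
    have "norm (oproj E x) - norm (oproj E y) \<le> norm (oproj E (x - y))"
      unfolding linear_diff[OF linear_oproj] by (rule norm_triangle_ineq2)
    also have "\<dots> \<le> norm (x - y)" by (rule norm_oproj_le)
    finally have 1: "norm (oproj E x) - norm (oproj E y) \<le> norm (x - y)" .
    have "norm (oproj E x) + norm (oproj E y) \<le> 2 * B"
      using assms(2,3) norm_oproj_le[of E x] norm_oproj_le[of E y] by linarith
    then have "(norm (oproj E x) + norm (oproj E y)) * norm (x - y) \<le> (2 * B) * norm (x - y)"
      by (rule mult_right_mono) simp
    moreover have "(norm (oproj E x) + norm (oproj E y)) * (norm (oproj E x) - norm (oproj E y))
        \<le> (norm (oproj E x) + norm (oproj E y)) * norm (x - y)"
      by (rule mult_left_mono[OF 1]) simp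
    ultimately show ?thesis by linarith
  qed
  finally show ?thesis .
qed

lemma lyap_piece_has_derivative:
  assumes "(v has_vector_derivative v') (at t within T)"
  shows "((\<lambda>s. lyap_piece c E (v s)) has_real_derivative 2 * (oproj E (v t) \<bullet> v')) (at t within T)"
proof -
  have "bounded_linear (oproj E)"
    using linear_oproj[of E] by (simp only: linear_conv_bounded_linear)
  then have *: "((\<lambda>s. oproj E (v s)) has_derivative (\<lambda>x. x *\<^sub>R oproj E v')) (at t within T)"
    using assms unfolding has_vector_derivative_def[symmetric] by (rule bounded_linear.has_vector_derivative)
  have "((\<lambda>s. oproj E (v s) \<bullet> oproj E (v s) + c (card E)) has_derivative
      (\<lambda>x. oproj E (v t) \<bullet> (x *\<^sub>R oproj E v') + (x *\<^sub>R oproj E v') \<bullet> oproj E (v t) + 0)) (at t within T)"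
    by (rule has_derivative_add[OF has_derivative_inner[OF * *] has_derivative_const])
  moreover have "(\<lambda>x. oproj E (v t) \<bullet> (x *\<^sub>R oproj E v') + (x *\<^sub>R oproj E v') \<bullet> oproj E (v t) + 0)
      = (*) (2 * (oproj E (v t) \<bullet> v'))"
    using oproj_inner_oproj[of E "v t" v'] by (simp add: fun_eq_iff inner_commute[of "oproj E v'" "oproj E (v t)"])
  ultimately show ?thesis
    by (simp add: lyap_piece_def has_field_derivative_def power2_norm_eq_inner)
qed

text \<open>The condition on \<open>v'\<close> is dual: it says that \<open>- v'\<close> lies in the
  convex cone generated by those \<open>d\<close> with
  \<open>- \<epsilon> \<le> v t \<bullet> d\<close>. Testing it with
  \<open>p = oproj E (v t)\<close> for an active piece \<open>E\<close> shows that this piece has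
  nonpositive derivative. Inactive pieces stay below the maximum for a short time, and there are
  only finitely many pieces.\<close>

lemma lyap_nonincreasing:
  fixes v :: "real \<Rightarrow> 'a::euclidean_space"
  assumes fin: "finite D" and gap: "level_gap c \<epsilon> D"
    and ac: "abs_cont_on v {a..b}" and "a \<le> b" and N: "negligible N"
    and deriv: "\<And>t. t \<in> {a..b} - N \<Longrightarrow> \<exists>v'. (v has_vector_derivative v') (at t within {a..b}) \<and>
      (\<forall>p. (\<forall>d\<in>D. - \<epsilon> \<le> v t \<bullet> d \<longrightarrow> 0 \<le> p \<bullet> d) \<longrightarrow> p \<bullet> v' \<le> 0)"
  shows "lyap c D (v b) \<le> lyap c D (v a)"
proof (rule abs_cont_on_nonincreasing[of "\<lambda>t. lyap c D (v t)", OF _ \<open>a \<le> b\<close> N])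
  have "bounded (v ` {a..b})"
    by (intro compact_imp_bounded compact_continuous_image abs_cont_on_imp_continuous_on ac) simp
  then obtain B where "0 < B" and B: "\<And>t. t \<in> {a..b} \<Longrightarrow> norm (v t) \<le> B"
    unfolding bounded_pos by auto
  show "abs_cont_on (\<lambda>t. lyap c D (v t)) {a..b}"
  proof (rule abs_cont_on_dominated[OF ac, of "2 * B" 0])
    fix x y assume "x \<in> {a..b}" "y \<in> {a..b}"
    then show "norm (lyap c D (v y) - lyap c D (v x)) \<le> 2 * B * norm (v y - v x) + 0 * \<bar>y - x\<bar>"
      using lyap_lipschitz[OF fin B B, of x y c] lyap_lipschitz[OF fin B B, of y x c]
      by (simp add: abs_le_iff norm_minus_commute)
  qed (use \<open>0 < B\<close> in auto)
  fix t e :: real assume t: "t \<in> {a..b} - N" and "0 < e"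
  define G where "G = lyap c D (v t)"
  obtain v' where v': "(v has_vector_derivative v') (at t within {a..b})"
    and dec: "\<And>p. (\<And>d. d \<in> D \<Longrightarrow> - \<epsilon> \<le> v t \<bullet> d \<Longrightarrow> 0 \<le> p \<bullet> d) \<Longrightarrow> p \<bullet> v' \<le> 0"
    using deriv[OF t] by auto
  have G: "lyap_piece c E (v t) \<le> G" if "E \<subseteq> D" for E
    unfolding G_def using fin that by (rule lyap_piece_le)
  \<comment> \<open>Forward in time every piece must be bounded above. Backward in time a lower
    bound for one active piece suffices, as the maximum dominates it.\<close>
  have ev: "\<forall>\<^sub>F s in at t within {a..b}.
     (t \<le> s \<longrightarrow> lyap_piece c E (v s) \<le> G + e * (s - t)) \<and>
     (lyap_piece c E (v t) = G \<longrightarrow> s \<le> t \<longrightarrow> G - e * (t - s) \<le> lyap_piece c E (v s))" if E: "E \<in> Pow D" for E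
  proof (cases "lyap_piece c E (v t) = G")
    case True
    have neg: "oproj E (v t) \<bullet> v' \<le> 0"
      using E True by (intro dec active_piece_inner_nonneg[OF fin gap]) (auto simp: G_def)
    have "\<forall>\<^sub>F s in at t within {a..b}. norm (lyap_piece c E (v s) - lyap_piece c E (v t)
        - 2 * (oproj E (v t) \<bullet> v') * (s - t)) \<le> e * norm (s - t)"
      using lyap_piece_has_derivative[OF v', of c E] \<open>0 < e\<close>
      unfolding has_field_derivative_def has_derivative_within_alt2 by blast
    then show ?thesis
    proof (rule eventually_mono, intro conjI impI)
      fix s assume *: "norm (lyap_piece c E (v s) - lyap_piece c E (v t)
        - 2 * (oproj E (v t) \<bullet> v') * (s - t)) \<le> e * norm (s - t)"
      show "lyap_piece c E (v s) \<le> G + e * (s - t)" if "t \<le> s"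
        using * True that mult_nonpos_nonneg[OF neg, of "s - t"] by (simp add: abs_le_iff)
      show "G - e * (t - s) \<le> lyap_piece c E (v s)" if "s \<le> t"
        using * True that mult_nonpos_nonpos[OF neg, of "s - t"] by (simp add: abs_le_iff)
    qed
  next
    case False
    then have less: "lyap_piece c E (v t) < G"
      using G[of E] E by simp
    have "continuous (at t within {a..b}) (\<lambda>s. lyap_piece c E (v s))"
      by (rule DERIV_continuous[OF lyap_piece_has_derivative[OF v']])
    then have "((\<lambda>s. lyap_piece c E (v s)) \<longlongrightarrow> lyap_piece c E (v t)) (at t within {a..b})"
      by (simp add: continuous_within)
    from order_tendstoD(2)[OF this less]
    have "\<forall>\<^sub>F s in at t within {a..b}. lyap_piece c E (v s) < G" .
    then show ?thesis
    proof (rule eventually_mono)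
      fix s assume *: "lyap_piece c E (v s) < G"
      have "lyap_piece c E (v s) \<le> G + e * (s - t)" if "t \<le> s"
        using * mult_nonneg_nonneg[of e "s - t"] \<open>0 < e\<close> that by linarith
      with False show "(t \<le> s \<longrightarrow> lyap_piece c E (v s) \<le> G + e * (s - t)) \<and>
         (lyap_piece c E (v t) = G \<longrightarrow> s \<le> t \<longrightarrow> G - e * (t - s) \<le> lyap_piece c E (v s))"
        by simp
    qed
  qed
  have "\<forall>\<^sub>F s in at t within {a..b}. \<forall>E\<in>Pow D.
     (t \<le> s \<longrightarrow> lyap_piece c E (v s) \<le> G + e * (s - t)) \<and>
     (lyap_piece c E (v t) = G \<longrightarrow> s \<le> t \<longrightarrow> G - e * (t - s) \<le> lyap_piece c E (v s))"
    using fin ev by (intro eventually_ball_finite) auto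
  then obtain d where "0 < d" and d: "\<forall>s\<in>{a..b}. s \<noteq> t \<and> dist s t < d \<longrightarrow> (\<forall>E\<in>Pow D.
     (t \<le> s \<longrightarrow> lyap_piece c E (v s) \<le> G + e * (s - t)) \<and>
     (lyap_piece c E (v t) = G \<longrightarrow> s \<le> t \<longrightarrow> G - e * (t - s) \<le> lyap_piece c E (v s)))"
    unfolding eventually_at by (elim exE conjE) (rule that)
  show "\<exists>d>0. \<forall>u w. a \<le> u \<and> u \<le> t \<and> t \<le> w \<and> w \<le> b \<and> t - u < d \<and> w - t < d \<longrightarrow>
      lyap c D (v w) - lyap c D (v u) \<le> e * (w - u)"
  proof (intro exI[of _ d] conjI allI impI, fact)
    fix u w assume uw: "a \<le> u \<and> u \<le> t \<and> t \<le> w \<and> w \<le> b \<and> t - u < d \<and> w - t < d"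
    have "lyap c D (v w) \<le> G + e * (w - t)"
    \<comment> \<open>The punctured filter at \<open>t\<close> says nothing about \<open>t\<close>
      itself.\<close>
    proof (cases "w = t")
      case False
      obtain E where E: "E \<subseteq> D" "lyap c D (v w) = lyap_piece c E (v w)"
        using lyap_attained[OF fin] .
      have "w \<in> {a..b}" "w \<noteq> t \<and> dist w t < d" "E \<in> Pow D"
        using uw False E by (auto simp: dist_real_def)
      then show ?thesis
        using d uw E by simp
    qed (simp add: G_def)
    moreover have "G - e * (t - u) \<le> lyap c D (v u)"
    proof (cases "u = t")
      case False
      obtain E where E: "E \<subseteq> D" "lyap c D (v t) = lyap_piece c E (v t)"
        using lyap_attained[OF fin] .
      have "u \<in> {a..b}" "u \<noteq> t \<and> dist u t < d" "E \<in> Pow D"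
        using uw False E by (auto simp: dist_real_def)
      then have "G - e * (t - u) \<le> lyap_piece c E (v u)"
        using d uw E by (simp add: G_def)
      also have "\<dots> \<le> lyap c D (v u)"
        using fin E by (intro lyap_piece_le)
      finally show ?thesis .
    qed (simp add: G_def)
    ultimately show "lyap c D (v w) - lyap c D (v u) \<le> e * (w - u)"
      by (simp add: algebra_simps)
  qed
qed

section \<open>Weighted max-weight dynamics\<close>

definition zero_entry :: "'n \<Rightarrow> real^'n \<Rightarrow> real^'n" where
  "zero_entry i x = (\<chi> j. if j = i then 0 else x $ j)"

definition gain :: "real^'n^'n \<Rightarrow> real^'n \<Rightarrow> real^'n \<Rightarrow> real^'n \<Rightarrow> real" where
  "gain R w x \<mu> = x \<bullet> (diagm w *v ((mat 1 - R) *v \<mu>))"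

definition sqd :: "real^'n \<Rightarrow> real^'n^'n" where
  "sqd w = diagm (\<chi> i. sqrt (w $ i))"

definition drift :: "real^'n^'n \<Rightarrow> real^'n \<Rightarrow> real^'n \<Rightarrow> real^'n" where
  "drift R w \<mu> = sqd w *v ((mat 1 - R) *v \<mu>)"

definition drift_diffs :: "real^'n^'n \<Rightarrow> real^'n \<Rightarrow> (real^'n) set \<Rightarrow> (real^'n) set" where
  "drift_diffs R w S = (\<lambda>(\<mu>, \<nu>). drift R w \<mu> - drift R w \<nu>) ` (S \<times> S)"

definition near_max :: "real^'n^'n \<Rightarrow> (real^'n) set \<Rightarrow> real^'n \<Rightarrow> real \<Rightarrow> real^'n \<Rightarrow> (real^'n) set" where
  "near_max R S w \<epsilon> x = {\<mu> \<in> S. \<forall>\<nu>\<in>S. gain R w x \<nu> \<le> gain R w x \<mu> + \<epsilon>}"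

lemma linear_drift: "linear (drift R w)"
  unfolding drift_def
  using linear_compose[OF matrix_vector_mul_linear matrix_vector_mul_linear] by (simp add: o_def)

lemma linear_zero_entry: "linear (zero_entry i)"
  by (rule linearI) (auto simp: zero_entry_def vec_eq_iff)

lemma diagm_mult_nth: "(diagm w *v x) $ i = w $ i * x $ i"
  by (simp add: diagm_def matrix_vector_mult_def if_distrib[of "\<lambda>a. a * _"] cong: if_cong)

lemma Sw_eq_near_max: "Sw R S w x = near_max R S w 0 x"
  by (simp add: Sw_def near_max_def gain_def)

text \<open>Splitting \<open>diagm w\<close> evenly between state and drift turns the weighted
  objective into a Euclidean inner product, so that orthogonal projections apply.\<close>

lemma sqd_inner_drift:
  assumes "pos_vec w"
  shows "(sqd w *v x) \<bullet> drift R w \<mu> = gain R w x \<mu>"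
proof -
  have *: "sqrt (w $ i) * a * (sqrt (w $ i) * b) = a * (w $ i * b)" for i a b
  proof -
    have "sqrt (w $ i) * a * (sqrt (w $ i) * b) = (sqrt (w $ i) * sqrt (w $ i)) * (a * b)"
      by (simp only: mult_ac)
    also have "\<dots> = a * (w $ i * b)"
      using assms by (simp add: pos_vec_def less_imp_le)
    finally show ?thesis .
  qed
  show ?thesis
    by (simp add: drift_def gain_def sqd_def inner_vec_def diagm_mult_nth *)
qed

text \<open>Serving queue \<open>i\<close> earns at most \<open>w $ i * x $ i\<close> per unit: work
  routed onwards by the nonnegative \<open>R\<close> can only lower the objective.\<close>

lemma gain_zero_entry:
  assumes R: "\<And>i j. 0 \<le> R $ i $ j" and w: "pos_vec w" and x: "nonneg_vec x" and "0 \<le> \<mu> $ i"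
  shows "gain R w x \<mu> \<le> gain R w x (zero_entry i \<mu>) + w $ i * x $ i * \<mu> $ i"
proof -
  have eq: "\<mu> = zero_entry i \<mu> + \<mu> $ i *\<^sub>R axis i 1"
    by (auto simp: vec_eq_iff zero_entry_def axis_def)
  have "gain R w x \<mu> = gain R w x (zero_entry i \<mu>) + \<mu> $ i * gain R w x (axis i 1)"
    by (subst eq)
      (simp only: gain_def matrix_vector_right_distrib matrix_vector_mult_scaleR inner_add_right inner_scaleR_right)
  moreover have "gain R w x (axis i 1) \<le> w $ i * x $ i"
  proof -
    have "gain R w x (axis i 1) = (\<Sum>j\<in>UNIV. x $ j * (w $ j * ((if j = i then 1 else 0) - R $ j $ i)))"
      by (simp add: gain_def inner_vec_def diagm_mult_nth matrix_vector_mult_basis column_def mat_def)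
    also have "\<dots> \<le> (\<Sum>j\<in>UNIV. if j = i then w $ i * x $ i else 0)"
    proof (rule sum_mono)
      fix j
      have "0 \<le> x $ j * (w $ j * R $ j $ i)"
        using R w x by (simp add: pos_vec_def nonneg_vec_def less_imp_le)
      then show "x $ j * (w $ j * ((if j = i then 1 else 0) - R $ j $ i)) \<le> (if j = i then w $ i * x $ i else 0)"
        by (cases "j = i") (simp_all add: algebra_simps)
    qed
    finally show ?thesis by simp
  qed
  ultimately show ?thesis
    using mult_left_mono[of "gain R w x (axis i 1)" "w $ i * x $ i" "\<mu> $ i"] \<open>0 \<le> \<mu> $ i\<close>
    by (simp add: mult.commute)
qed

section \<open>Truncated and idling service as convex combinations\<close>

lemma shrink_in_convex:
  fixes m u :: "real^'n"
  assumes "convex X" and "finite J" and zero: "\<And>i x. \<lbrakk>i \<in> J; x \<in> X\<rbrakk> \<Longrightarrow> zero_entry i x \<in> X" and "m \<in> X"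
    and "\<And>i. i \<in> J \<Longrightarrow> 0 \<le> u $ i \<and> u $ i \<le> m $ i" and "\<And>i. i \<notin> J \<Longrightarrow> u $ i = m $ i"
  shows "u \<in> X"
  using assms(2,3,5,6)
proof (induction J arbitrary: u rule: finite_induct)
  case empty
  then have "u = m" by (simp add: vec_eq_iff)
  then show ?case using \<open>m \<in> X\<close> by simp
next
  case (insert i J)
  \<comment> \<open>Entries are lowered one at a time; \<open>u'\<close> still has the full entry
    \<open>i\<close>, and \<open>u\<close> lies on the segment from \<open>u'\<close> to
    \<open>zero_entry i u'\<close>.\<close>
  define u' :: "real^'n" where "u' = (\<chi> j. if j = i then m $ i else u $ j)"
  have "u' \<in> X"
  proof (rule insert.IH)
    show "zero_entry j x \<in> X" if "j \<in> J" "x \<in> X" for j x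
      using insert.prems(1) that by simp
    show "0 \<le> u' $ j \<and> u' $ j \<le> m $ j" if "j \<in> J" for j
      using insert.prems(2)[of j] insert.hyps that by (auto simp: u'_def)
    show "u' $ j = m $ j" if "j \<notin> J" for j
      using insert.prems(3)[of j] that by (simp add: u'_def)
  qed
  have ui: "0 \<le> u $ i" "u $ i \<le> m $ i"
    using insert.prems(2)[of i] by auto
  show ?case
  proof (cases "m $ i = 0")
    case True
    then have "u = u'" using ui by (auto simp: vec_eq_iff u'_def)
    then show ?thesis using \<open>u' \<in> X\<close> by simp
  next
    case False
    define r where "r = u $ i / m $ i"
    have r: "0 \<le> r" "r \<le> 1"
      using ui False by (auto simp: r_def divide_le_eq_1)
    have "r *\<^sub>R u' + (1 - r) *\<^sub>R zero_entry i u' \<in> X"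
      using \<open>convex X\<close> \<open>u' \<in> X\<close> insert.prems(1)[of i u'] r by (intro convexD) auto
    moreover have "r *\<^sub>R u' + (1 - r) *\<^sub>R zero_entry i u' = u"
      using False by (auto simp: vec_eq_iff u'_def zero_entry_def r_def algebra_simps)
    ultimately show ?thesis by simp
  qed
qed

text \<open>Zeroing an entry is linear, so closure of \<open>Y\<close> under it passes to the convex
  hull.\<close>

lemma shrink_in_hull:
  fixes m u :: "real^'n"
  assumes zero: "\<And>i x. \<lbrakk>i \<in> J; x \<in> Y\<rbrakk> \<Longrightarrow> zero_entry i x \<in> Y" and "m \<in> convex hull Y"
    and "\<And>i. i \<in> J \<Longrightarrow> 0 \<le> u $ i \<and> u $ i \<le> m $ i" and "\<And>i. i \<notin> J \<Longrightarrow> u $ i = m $ i"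
  shows "u \<in> convex hull Y"
proof (rule shrink_in_convex[of _ J])
  show "zero_entry i x \<in> convex hull Y" if "i \<in> J" "x \<in> convex hull Y" for i x
  proof -
    have "zero_entry i x \<in> convex hull (zero_entry i ` Y)"
      using convex_hull_linear_image[OF linear_zero_entry, of i Y] that by blast
    also have "\<dots> \<subseteq> convex hull Y"
      by (rule hull_mono) (use zero that in auto)
    finally show ?thesis .
  qed
qed (use assms in auto)

text \<open>Idling happens only at empty queues, where zeroing the service entry costs no objective
  value. Hence the maximizers are closed under these zeroings and \<open>y\<close> can be absorbed
  into the convex combination.\<close>

lemma fluid_rate_in_hull:
  assumes net: "network R S" and w: "pos_vec w" and x: "nonneg_vec x"
    and s: "\<And>\<mu>. \<mu> \<in> S \<Longrightarrow> 0 \<le> s \<mu>" "(\<Sum>\<mu>\<in>S. s \<mu>) = 1"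
    and s0: "\<And>\<mu>. \<lbrakk>\<mu> \<in> S; \<mu> \<notin> Sw R S w x\<rbrakk> \<Longrightarrow> s \<mu> = 0"
    and y: "nonneg_vec y" "\<And>i. y $ i \<le> (\<Sum>\<mu>\<in>S. s \<mu> * \<mu> $ i)" "\<And>i. x $ i > 0 \<Longrightarrow> y $ i = 0"
  shows "(\<Sum>\<mu>\<in>S. s \<mu> *\<^sub>R \<mu>) - y \<in> convex hull Sw R S w x"
proof (rule shrink_in_hull[of "{i. x $ i = 0}"])
  have fin: "finite S" and sub: "Sw R S w x \<subseteq> S"
    using net by (auto simp: network_def Sw_def)
  have "(\<Sum>\<mu>\<in>S. s \<mu> *\<^sub>R \<mu>) = (\<Sum>\<mu>\<in>Sw R S w x. s \<mu> *\<^sub>R \<mu>)"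
    using s0 by (intro sum.mono_neutral_right fin sub) auto
  also have "\<dots> \<in> convex hull Sw R S w x"
  proof (rule convex_sum)
    have "(\<Sum>\<mu>\<in>S. s \<mu>) = (\<Sum>\<mu>\<in>Sw R S w x. s \<mu>)"
      using s0 by (intro sum.mono_neutral_right fin sub) auto
    then show "(\<Sum>\<mu>\<in>Sw R S w x. s \<mu>) = 1" using s by simp
  qed (use s sub fin finite_subset in \<open>auto intro: hull_inc\<close>)
  finally show "(\<Sum>\<mu>\<in>S. s \<mu> *\<^sub>R \<mu>) \<in> convex hull Sw R S w x" .
  show "zero_entry i \<mu> \<in> Sw R S w x" if i: "i \<in> {i. x $ i = 0}" and \<mu>: "\<mu> \<in> Sw R S w x" for i \<mu>
  proof -
    have "\<mu> \<in> S" "0 \<le> \<mu> $ i" "zero_entry i \<mu> \<in> S"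
      using \<mu> net by (auto simp: Sw_def network_def nonneg_vec_def zero_entry_def)
    moreover have "gain R w x \<mu> \<le> gain R w x (zero_entry i \<mu>) + w $ i * x $ i * \<mu> $ i"
      using net w x \<open>0 \<le> \<mu> $ i\<close> by (intro gain_zero_entry) (auto simp: network_def)
    ultimately show ?thesis
      using i \<mu> by (force simp: Sw_eq_near_max near_max_def)
  qed
  show "0 \<le> ((\<Sum>\<mu>\<in>S. s \<mu> *\<^sub>R \<mu>) - y) $ i \<and> ((\<Sum>\<mu>\<in>S. s \<mu> *\<^sub>R \<mu>) - y) $ i \<le> (\<Sum>\<mu>\<in>S. s \<mu> *\<^sub>R \<mu>) $ i" for i
    using y(1) y(2)[of i] by (simp add: nonneg_vec_def)
  show "((\<Sum>\<mu>\<in>S. s \<mu> *\<^sub>R \<mu>) - y) $ i = (\<Sum>\<mu>\<in>S. s \<mu> *\<^sub>R \<mu>) $ i" if "i \<notin> {i. x $ i = 0}" for i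
  proof -
    have "0 < x $ i" using that x by (auto simp: nonneg_vec_def less_le)
    then show ?thesis using y(3) by simp
  qed
qed

text \<open>Where \<open>\<mu>\<close> exceeds the queue length, the queue is shorter than a constant, so zeroing that entry of
  \<open>\<mu>\<close> costs only a bounded amount of weight.\<close>

lemma vmin_in_hull_near_max:
  assumes net: "network R S" and w: "pos_vec w" and x: "nonneg_vec x" and \<mu>: "\<mu> \<in> Sw R S w x"
    and \<epsilon>: "(\<Sum>i\<in>UNIV. w $ i * (\<mu> $ i)\<^sup>2) \<le> \<epsilon>"
  shows "vmin \<mu> x \<in> convex hull near_max R S w \<epsilon> x"
proof -
  define J where "J = {i. x $ i < \<mu> $ i}"
  \<comment> \<open>The allowed loss is charged entry by entry according to what was removed from
    \<open>\<mu>\<close>. Zeroing an entry raises the allowance by exactly the bound of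
    \<open>gain_zero_entry\<close>, so \<open>Y\<close> is closed under zeroing in
    \<open>J\<close>.\<close>
  define Y where "Y = {\<kappa> \<in> S. (\<forall>\<nu>\<in>S. gain R w x \<nu> \<le> gain R w x \<kappa> + (\<Sum>i\<in>UNIV. w $ i * x $ i * (\<mu> $ i - \<kappa> $ i)))
    \<and> (\<forall>i. i \<notin> J \<longrightarrow> \<kappa> $ i = \<mu> $ i)}"
  have "\<mu> \<in> S" and nonneg: "\<And>\<kappa> i. \<kappa> \<in> S \<Longrightarrow> 0 \<le> \<kappa> $ i"
    using \<mu> net by (auto simp: Sw_def network_def nonneg_vec_def)
  have "vmin \<mu> x \<in> convex hull Y"
  proof (rule shrink_in_hull[of J])
    show "zero_entry i \<kappa> \<in> Y" if i: "i \<in> J" and \<kappa>: "\<kappa> \<in> Y" for i \<kappa>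
    proof -
      have "\<kappa> \<in> S" using \<kappa> by (simp add: Y_def)
      then have "zero_entry i \<kappa> \<in> S"
        using net by (simp add: network_def zero_entry_def)
      moreover have "gain R w x \<kappa> \<le> gain R w x (zero_entry i \<kappa>) + w $ i * x $ i * \<kappa> $ i"
        using net w x nonneg[OF \<open>\<kappa> \<in> S\<close>] by (intro gain_zero_entry) (auto simp: network_def)
      moreover have "(\<Sum>j\<in>UNIV. w $ j * x $ j * (\<mu> $ j - zero_entry i \<kappa> $ j))
          = (\<Sum>j\<in>UNIV. w $ j * x $ j * (\<mu> $ j - \<kappa> $ j)) + w $ i * x $ i * \<kappa> $ i"
      proof -
        have "(\<Sum>j\<in>UNIV. w $ j * x $ j * (\<mu> $ j - zero_entry i \<kappa> $ j))
          = (\<Sum>j\<in>UNIV. w $ j * x $ j * (\<mu> $ j - \<kappa> $ j) + (if j = i then w $ i * x $ i * \<kappa> $ i else 0))"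
          by (intro sum.cong refl) (simp add: zero_entry_def algebra_simps)
        then show ?thesis by (simp add: sum.distrib)
      qed
      moreover have "zero_entry i \<kappa> $ j = \<mu> $ j" if "j \<notin> J" for j
        using that i \<kappa> by (auto simp: zero_entry_def Y_def)
      ultimately show ?thesis
        using \<kappa> by (force simp: Y_def)
    qed
    have "\<mu> \<in> Y"
      using \<mu> by (simp add: Y_def Sw_eq_near_max near_max_def)
    then show "\<mu> \<in> convex hull Y" by (rule hull_inc)
    show "0 \<le> vmin \<mu> x $ i \<and> vmin \<mu> x $ i \<le> \<mu> $ i" for i
      using nonneg[OF \<open>\<mu> \<in> S\<close>] x by (simp add: vmin_def nonneg_vec_def)
    show "vmin \<mu> x $ i = \<mu> $ i" if "i \<notin> J" for i
      using that by (simp add: vmin_def J_def)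
  qed
  also have "convex hull Y \<subseteq> convex hull near_max R S w \<epsilon> x"
  proof (rule hull_mono, rule subsetI)
    fix \<kappa> assume \<kappa>: "\<kappa> \<in> Y"
    have "(\<Sum>i\<in>UNIV. w $ i * x $ i * (\<mu> $ i - \<kappa> $ i)) \<le> (\<Sum>i\<in>UNIV. w $ i * (\<mu> $ i)\<^sup>2)"
    proof (rule sum_mono)
      fix i
      \<comment> \<open>On \<open>J\<close> the queue is shorter than its service entry, which makes
        the charge bounded independently of \<open>x\<close>; off \<open>J\<close> it is
        zero.\<close>
      have "x $ i * (\<mu> $ i - \<kappa> $ i) \<le> \<mu> $ i * \<mu> $ i"
      proof (cases "i \<in> J")
        case True
        have "0 \<le> \<kappa> $ i" "0 \<le> \<mu> $ i" "0 \<le> x $ i"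
          using \<kappa> nonneg \<open>\<mu> \<in> S\<close> x by (auto simp: Y_def nonneg_vec_def)
        then have "x $ i * (\<mu> $ i - \<kappa> $ i) \<le> x $ i * \<mu> $ i"
          by (intro mult_left_mono) auto
        also have "\<dots> \<le> \<mu> $ i * \<mu> $ i"
          using True \<open>0 \<le> \<mu> $ i\<close> by (intro mult_right_mono) (auto simp: J_def)
        finally show ?thesis .
      next
        case False
        then show ?thesis using \<kappa> by (simp add: Y_def)
      qed
      then have "w $ i * (x $ i * (\<mu> $ i - \<kappa> $ i)) \<le> w $ i * (\<mu> $ i * \<mu> $ i)"
        using w by (intro mult_left_mono) (auto simp: pos_vec_def less_imp_le)
      then show "w $ i * x $ i * (\<mu> $ i - \<kappa> $ i) \<le> w $ i * (\<mu> $ i)\<^sup>2"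
        by (simp add: power2_eq_square mult.assoc)
    qed
    then show "\<kappa> \<in> near_max R S w \<epsilon> x"
      using \<kappa> \<epsilon> by (force simp: Y_def near_max_def)
  qed
  finally show ?thesis .
qed

section \<open>Comparison of the trajectories over one time slot\<close>

lemma inner_le_on_hulls:
  assumes le: "\<And>x y. x \<in> X \<Longrightarrow> y \<in> Y \<Longrightarrow> p \<bullet> x \<le> p \<bullet> y"
    and "a \<in> convex hull X" "b \<in> convex hull Y"
  shows "p \<bullet> a \<le> p \<bullet> b"
proof -
  have "p \<bullet> a \<le> p \<bullet> y" if "y \<in> Y" for y
  proof -
    have "convex hull X \<subseteq> {x. p \<bullet> x \<le> p \<bullet> y}"
      by (rule hull_minimal) (use le that in \<open>auto simp: convex_halfspace_le\<close>)
    then show ?thesis using assms(2) by auto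
  qed
  then have "convex hull Y \<subseteq> {y. p \<bullet> y \<ge> p \<bullet> a}"
    by (intro hull_minimal) (auto simp: convex_halfspace_ge)
  then show ?thesis using assms(3) by auto
qed

text \<open>Hides \<open>s\<close> and \<open>y\<close>: almost everywhere the fluid moves with a
  single effective service rate from the hull of the maximizers.\<close>

lemma fluid_solutionE:
  assumes net: "network R S" and w: "pos_vec w" and fl: "fluid_solution R S w lam q"
  obtains N where "negligible N"
    "\<And>t. \<lbrakk>0 \<le> t; t \<notin> N\<rbrakk> \<Longrightarrow> \<exists>u \<in> convex hull Sw R S w (q t).
      (q has_vector_derivative (lam - (mat 1 - R) *v u)) (at t within {0..})"
proof -
  obtain s y where s: "\<forall>\<mu>\<in>S. \<forall>t\<ge>0. 0 \<le> s \<mu> t \<and> s \<mu> t \<le> 1" and y: "\<forall>t\<ge>0. nonneg_vec (y t)"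
    and ae: "AE t in lborel. 0 \<le> t \<longrightarrow>
           (q has_vector_derivative
              (lam + (R - mat 1) *v ((\<Sum>\<mu>\<in>S. s \<mu> t *\<^sub>R \<mu>) - y t))) (at t within {0..}) \<and>
           (\<Sum>\<mu>\<in>S. s \<mu> t) = 1 \<and>
           (\<forall>i. y t $ i \<le> (\<Sum>\<mu>\<in>S. s \<mu> t * \<mu> $ i)) \<and>
           (\<forall>i. q t $ i > 0 \<longrightarrow> y t $ i = 0) \<and>
           (\<forall>\<mu>\<in>S. \<mu> \<notin> Sw R S w (q t) \<longrightarrow> s \<mu> t = 0)" (is "AE t in lborel. ?P t")
    using fl unfolding fluid_solution_def by (elim exE conjE) (rule that)
  have q: "nonneg_vec (q t)" if "0 \<le> t" for t
    using fl that by (simp add: fluid_solution_def)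
  obtain N where N: "{t \<in> space lborel. \<not> ?P t} \<subseteq> N" "emeasure lborel N = 0" "N \<in> sets lborel"
    using AE_E[OF ae] .
  have "N \<in> null_sets lborel"
    using N by (simp add: null_sets_def)
  then have "negligible N"
    by (simp add: negligible_iff_null_sets null_sets_completionI)
  moreover have "\<exists>u \<in> convex hull Sw R S w (q t).
      (q has_vector_derivative (lam - (mat 1 - R) *v u)) (at t within {0..})" if t: "0 \<le> t" "t \<notin> N" for t
  proof -
    define u where "u = (\<Sum>\<mu>\<in>S. s \<mu> t *\<^sub>R \<mu>) - y t"
    have P: "?P t" using N(1) t by auto
    have "u \<in> convex hull Sw R S w (q t)"
      unfolding u_def using P s y q t by (intro fluid_rate_in_hull[OF net w]) auto
    moreover have "lam + (R - mat 1) *v u = lam - (mat 1 - R) *v u"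
      by (simp add: matrix_vector_mult_diff_rdistrib)
    ultimately show ?thesis
      using P t(1) by (intro bexI[of _ u]) (simp_all add: u_def[symmetric])
  qed
  ultimately show thesis by (rule that)
qed

text \<open>During one slot the discrete state, corrected by \<open>U\<close>, is interpolated
  linearly with velocity \<open>lam - (mat 1 - R) *v u\<close>. Of the tolerance \<epsilon>, the
  share \<open>\<epsilon>\<^sub>0\<close> pays for \<open>u\<close> being only nearly optimal at
  \<open>x\<close>. The rest pays, through \<open>small\<close>, for the correction \<open>U\<close>
  and the movement within the slot.\<close>

lemma lyap_step:
  fixes q :: "real \<Rightarrow> real^'n"
  assumes net: "network R S" and w: "pos_vec w" and fl: "fluid_solution R S w lam q"
    and gap: "level_gap c \<epsilon> (drift_diffs R w S)"
    and "0 \<le> j" and u: "u \<in> convex hull near_max R S w \<epsilon>\<^sub>0 x"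
    and small: "\<And>\<theta> d. \<lbrakk>0 \<le> \<theta>; \<theta> \<le> 1; d \<in> drift_diffs R w S\<rbrakk> \<Longrightarrow>
      - (\<epsilon> - \<epsilon>\<^sub>0) \<le> (sqd w *v (\<theta> *\<^sub>R lam - U) - \<theta> *\<^sub>R drift R w u) \<bullet> d"
  shows "lyap c (drift_diffs R w S) (sqd w *v (x - U + (lam - (mat 1 - R) *v u) - q (j + 1)))
    \<le> lyap c (drift_diffs R w S) (sqd w *v (x - U - q j))"
proof -
  define a where "a = lam - (mat 1 - R) *v u"
  define v where "v t = sqd w *v (x - U + (t - j) *\<^sub>R a - q t)" for t
  obtain N where N: "negligible N" and qd: "\<And>t. \<lbrakk>0 \<le> t; t \<notin> N\<rbrakk> \<Longrightarrow> \<exists>u \<in> convex hull Sw R S w (q t).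
      (q has_vector_derivative (lam - (mat 1 - R) *v u)) (at t within {0..})"
    using fluid_solutionE[OF net w fl] by blast
  have "lyap c (drift_diffs R w S) (v (j + 1)) \<le> lyap c (drift_diffs R w S) (v j)"
  proof (rule lyap_nonincreasing[OF _ gap _ _ N])
    show "finite (drift_diffs R w S)"
      using net by (simp add: drift_diffs_def network_def)
    have "abs_cont_on q {0..j + 1}"
      using fl \<open>0 \<le> j\<close> by (simp add: fluid_solution_def)
    then have ac: "abs_cont_on q {j..j + 1}"
      by (rule abs_cont_on_subset) (use \<open>0 \<le> j\<close> in auto)
    obtain B where "0 < B" and B: "\<And>z. norm (sqd w *v z) \<le> B * norm z"
      using linear_bounded_pos[OF matrix_vector_mul_linear] by blast
    show "abs_cont_on v {j..j + 1}"
    proof (rule abs_cont_on_dominated[OF ac, of B "B * norm a"])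
      fix y z :: real
      have "v z - v y = sqd w *v ((z - y) *\<^sub>R a - (q z - q y))"
        by (simp add: v_def matrix_vector_mult_diff_distrib[symmetric] algebra_simps)
      then have "norm (v z - v y) \<le> B * norm ((z - y) *\<^sub>R a - (q z - q y))"
        using B by simp
      also have "\<dots> \<le> B * (\<bar>z - y\<bar> * norm a + norm (q z - q y))"
        using \<open>0 < B\<close> norm_triangle_ineq4[of "(z - y) *\<^sub>R a" "q z - q y"] by (intro mult_left_mono) auto
      finally show "norm (v z - v y) \<le> B * norm (q z - q y) + B * norm a * \<bar>z - y\<bar>"
        by (simp add: algebra_simps)
    qed (use \<open>0 < B\<close> in auto)
    fix t assume t: "t \<in> {j..j + 1} - N"
    then obtain u' where u': "u' \<in> convex hull Sw R S w (q t)"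
      and "(q has_vector_derivative (lam - (mat 1 - R) *v u')) (at t within {0..})"
      using qd[of t] \<open>0 \<le> j\<close> by auto
    then have dq: "(q has_vector_derivative (lam - (mat 1 - R) *v u')) (at t within {j..j + 1})"
      by (rule_tac has_vector_derivative_within_subset) (use \<open>0 \<le> j\<close> in auto)
    show "\<exists>v'. (v has_vector_derivative v') (at t within {j..j + 1}) \<and>
      (\<forall>p. (\<forall>d\<in>drift_diffs R w S. - \<epsilon> \<le> v t \<bullet> d \<longrightarrow> 0 \<le> p \<bullet> d) \<longrightarrow> p \<bullet> v' \<le> 0)"
    \<comment> \<open>Both velocities contain \<open>lam\<close>, which cancels.\<close>
    proof (intro exI[of _ "drift R w u' - drift R w u"] conjI allI impI)
      have "((\<lambda>t. x - U + (t - j) *\<^sub>R a - q t) has_vector_derivative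
          (a - (lam - (mat 1 - R) *v u'))) (at t within {j..j + 1})"
        using dq by (auto intro!: derivative_eq_intros)
      then have "(v has_vector_derivative sqd w *v (a - (lam - (mat 1 - R) *v u'))) (at t within {j..j + 1})"
        unfolding v_def by (rule bounded_linear.has_vector_derivative[OF matrix_vector_mul_bounded_linear])
      then show "(v has_vector_derivative drift R w u' - drift R w u) (at t within {j..j + 1})"
        by (simp add: a_def drift_def matrix_vector_mult_diff_distrib)
      fix p assume p: "\<forall>d\<in>drift_diffs R w S. - \<epsilon> \<le> v t \<bullet> d \<longrightarrow> 0 \<le> p \<bullet> d"
      have "p \<bullet> drift R w u' \<le> p \<bullet> drift R w u"
      proof (rule inner_le_on_hulls)
        show "drift R w u' \<in> convex hull (drift R w ` Sw R S w (q t))"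
          using u' unfolding convex_hull_linear_image[OF linear_drift, symmetric] by (rule imageI)
        show "drift R w u \<in> convex hull (drift R w ` near_max R S w \<epsilon>\<^sub>0 x)"
          using u unfolding convex_hull_linear_image[OF linear_drift, symmetric] by (rule imageI)
        fix y z assume "y \<in> drift R w ` Sw R S w (q t)" "z \<in> drift R w ` near_max R S w \<epsilon>\<^sub>0 x"
        then obtain \<mu> \<nu> where \<mu>: "y = drift R w \<mu>" "\<mu> \<in> Sw R S w (q t)"
          and \<nu>: "z = drift R w \<nu>" "\<nu> \<in> near_max R S w \<epsilon>\<^sub>0 x"
          by blast
        then have "\<mu> \<in> S" "\<nu> \<in> S"
          by (auto simp: Sw_def near_max_def)
        then have d: "z - y \<in> drift_diffs R w S"
          using \<mu> \<nu> by (auto simp: drift_diffs_def)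
        \<comment> \<open>Against \<open>z - y\<close> the three parts contribute at least
          \<open>- \<epsilon>\<^sub>0\<close> (near-optimality of \<open>\<nu>\<close> at
          \<open>x\<close>), 0 (optimality of \<open>\<mu>\<close> at \<open>q t\<close>) and
          \<open>- (\<epsilon> - \<epsilon>\<^sub>0)\<close>.\<close>
        have "v t = sqd w *v x - sqd w *v q t + (sqd w *v ((t - j) *\<^sub>R lam - U) - (t - j) *\<^sub>R drift R w u)"
          by (simp add: v_def a_def drift_def matrix_vector_mult_diff_distrib matrix_vector_right_distrib
              matrix_vector_mult_scaleR algebra_simps)
        moreover have "- \<epsilon>\<^sub>0 \<le> (sqd w *v x) \<bullet> (z - y)"
          using \<nu> \<open>\<mu> \<in> S\<close> by (auto simp: \<mu>(1) inner_diff_right sqd_inner_drift[OF w] near_max_def)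
        moreover have "(sqd w *v q t) \<bullet> (z - y) \<le> 0"
          using \<mu>(2) \<open>\<nu> \<in> S\<close> by (auto simp: \<mu>(1) \<nu>(1) inner_diff_right sqd_inner_drift[OF w] Sw_eq_near_max near_max_def)
        moreover have "- (\<epsilon> - \<epsilon>\<^sub>0) \<le> (sqd w *v ((t - j) *\<^sub>R lam - U) - (t - j) *\<^sub>R drift R w u) \<bullet> (z - y)"
          by (rule small[OF _ _ d]) (use t in auto)
        ultimately have "- \<epsilon> \<le> v t \<bullet> (z - y)"
          by (simp only: inner_add_left inner_diff_left)
        then have "0 \<le> p \<bullet> (z - y)"
          using p d by blast
        then show "p \<bullet> y \<le> p \<bullet> z"
          by (simp add: inner_diff_right)
      qed
      then show "p \<bullet> (drift R w u' - drift R w u) \<le> 0"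
        by (simp add: inner_diff_right)
    qed
  qed simp
  then show ?thesis
    by (simp add: v_def a_def)
qed

section \<open>Global bound by induction over time slots\<close>

lemma sqd_norm_bound:
  assumes "pos_vec w"
  obtains K where "0 < K" "\<And>x. norm x \<le> K * norm (sqd w *v x)"
proof -
  define T where "T = diagm (\<chi> i. 1 / sqrt (w $ i))"
  have eq: "T *v (sqd w *v x) = x" for x
    using assms by (simp add: T_def sqd_def vec_eq_iff diagm_mult_nth pos_vec_def less_imp_neq[THEN not_sym])
  obtain K where "0 < K" "\<And>x. norm (T *v x) \<le> K * norm x"
    using linear_bounded_pos[OF matrix_vector_mul_linear] by blast
  with that show thesis by (metis eq)
qed

text \<open>Truncation never removes more than the queue holds, while arrivals and routed work are
  nonnegative.\<close>

lemma wmw_process_nonneg: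
  assumes net: "network R S" and A: "\<And>t. nonneg_vec (A t)" and Q: "wmw_process R S w A Q"
  shows "nonneg_vec (Q t)"
proof (induction t)
  case 0
  then show ?case using Q by (simp add: wmw_process_def)
next
  case (Suc t)
  obtain \<mu> where "\<mu> \<in> Sw R S w (Q t)" and step: "Q (Suc t) = Q t + A t + (R - mat 1) *v vmin \<mu> (Q t)"
    using Q by (auto simp: wmw_process_def)
  then have \<mu>: "nonneg_vec \<mu>"
    using net by (auto simp: Sw_def network_def)
  have "0 \<le> Q (Suc t) $ i" for i
  proof -
    have "0 \<le> (R *v vmin \<mu> (Q t)) $ i"
      using net \<mu> Suc.IH by (auto simp: matrix_vector_mult_def network_def nonneg_vec_def vmin_def intro!: sum_nonneg)
    moreover have "vmin \<mu> (Q t) $ i \<le> Q t $ i" "0 \<le> A t $ i"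
      using A by (auto simp: vmin_def nonneg_vec_def)
    ultimately show ?thesis
      by (simp add: step matrix_vector_mult_diff_rdistrib)
  qed
  then show ?case by (simp add: nonneg_vec_def)
qed

theorem theorem2:
  fixes R :: "real^'n^'n" and S :: "(real^'n) set" and w :: "real^'n"
  assumes "network R S" and "pos_vec w"
  shows "\<exists>C::real. \<forall>(A::nat \<Rightarrow> real^'n) Q (lam::real^'n) (q::real \<Rightarrow> real^'n).
    (\<forall>t. nonneg_vec (A t)) \<longrightarrow> wmw_process R S w A Q \<longrightarrow> nonneg_vec lam \<longrightarrow>
    fluid_solution R S w lam q \<longrightarrow> q 0 = Q 0 \<longrightarrow>
    (\<forall>k::nat. norm (Q k - q (real k)) \<le>
       C * (1 + norm lam + max_below k (\<lambda>t. norm (\<Sum>\<tau>\<le>t. A \<tau> - lam))))"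
proof -
  note net = assms(1) and w = assms(2)
  define D where "D = drift_diffs R w S"
  define \<beta> where "\<beta> = (\<Sum>\<mu>\<in>S. norm (drift R w \<mu>))"
  define \<epsilon>\<^sub>0 where "\<epsilon>\<^sub>0 = (\<Sum>\<mu>\<in>S. \<Sum>i\<in>UNIV. w $ i * (\<mu> $ i)\<^sup>2)"
  have finS: "finite S" using net by (simp add: network_def)
  then have finD: "finite D" by (simp add: D_def drift_diffs_def)
  have wpos: "0 \<le> w $ i" for i using w by (simp add: pos_vec_def less_imp_le)
  have "0 \<le> \<beta>" "0 \<le> \<epsilon>\<^sub>0"
    unfolding \<beta>_def \<epsilon>\<^sub>0_def using wpos by (auto intro!: sum_nonneg)
  have \<beta>: "norm (drift R w \<mu>) \<le> \<beta>" if "\<mu> \<in> S" for \<mu>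
    unfolding \<beta>_def using finS that by (intro member_le_sum) auto
  have \<epsilon>\<^sub>0: "(\<Sum>i\<in>UNIV. w $ i * (\<mu> $ i)\<^sup>2) \<le> \<epsilon>\<^sub>0" if "\<mu> \<in> S" for \<mu>
    unfolding \<epsilon>\<^sub>0_def using finS that wpos
    by (intro member_le_sum[of \<mu> S "\<lambda>\<mu>. \<Sum>i\<in>UNIV. w $ i * (\<mu> $ i)\<^sup>2"] sum_nonneg) auto
  have \<beta>_hull: "norm (drift R w u) \<le> \<beta>" if "u \<in> convex hull Y" "Y \<subseteq> S" for u Y
  proof -
    have "drift R w u \<in> convex hull (drift R w ` Y)"
      using that(1) unfolding convex_hull_linear_image[OF linear_drift, symmetric] by (rule imageI)
    also have "\<dots> \<subseteq> cball 0 \<beta>"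
      using \<beta> that(2) by (intro hull_minimal) auto
    finally show ?thesis by simp
  qed
  have D_norm: "norm d \<le> 2 * \<beta>" if d: "d \<in> D" for d
  proof -
    obtain \<mu> \<nu> where "\<mu> \<in> S" "\<nu> \<in> S" "d = drift R w \<mu> - drift R w \<nu>"
      using d by (auto simp: D_def drift_diffs_def)
    then show ?thesis
      using \<beta>[of \<mu>] \<beta>[of \<nu>] norm_triangle_ineq4[of "drift R w \<mu>" "drift R w \<nu>"] by simp
  qed
  obtain KT where "0 < KT" and KT: "\<And>x. norm (sqd w *v x) \<le> KT * norm x"
    using linear_bounded_pos[OF matrix_vector_mul_linear] by blast
  obtain KI where "0 < KI" and KI: "\<And>x. norm x \<le> KI * norm (sqd w *v x)"
    using sqd_norm_bound[OF w] by blast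
  obtain \<gamma> :: "nat \<Rightarrow> real" where "mono \<gamma>" and gap: "\<And>\<epsilon>. 0 < \<epsilon> \<Longrightarrow> level_gap (\<lambda>k. \<epsilon>\<^sup>2 * \<gamma> k) \<epsilon> D"
    using level_gap_exists[OF finD] by blast
  have "\<gamma> 0 = 0" using gap[of 1] by (simp add: level_gap_def)
  then have "0 \<le> \<gamma> (card D)" using monoD[OF \<open>mono \<gamma>\<close>, of 0 "card D"] by simp
  \<comment> \<open>The summands pay for the slack of truncated service, the drift within a slot,
    and the rate together with the fluctuations; differences in \<open>D\<close> have norm at most
    \<open>2 * \<beta>\<close>. The final 1 ensures positivity.\<close>
  define c\<^sub>0 where "c\<^sub>0 = \<epsilon>\<^sub>0 + 2 * \<beta> * \<beta> + 2 * \<beta> * KT + 1"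
  have "0 < c\<^sub>0"
    using \<open>0 \<le> \<beta>\<close> \<open>0 \<le> \<epsilon>\<^sub>0\<close> \<open>0 < KT\<close> by (simp add: c\<^sub>0_def add_nonneg_pos)
  show ?thesis
  \<comment> \<open>\<open>KI\<close> undoes the change of coordinates, the square root comes from
    the top level of the Lyapunov function, and the summand 1 pays for adding \<open>U k\<close>
    back.\<close>
  proof (intro exI[of _ "KI * c\<^sub>0 * sqrt (\<gamma> (card D)) + 1"] allI impI)
    fix A :: "nat \<Rightarrow> real^'n" and Q and lam :: "real^'n" and q :: "real \<Rightarrow> real^'n" and k :: nat
    assume A: "\<forall>t. nonneg_vec (A t)" and Q: "wmw_process R S w A Q"
      and fl: "fluid_solution R S w lam q" and q0: "q 0 = Q 0"
    define M where "M = max_below k (\<lambda>t. norm (\<Sum>\<tau>\<le>t. A \<tau> - lam))"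
    \<comment> \<open>The sum stops before \<open>j\<close>, so for \<open>0 < j\<close> the vector
      \<open>U j\<close> is the fluctuation up to time \<open>j - 1\<close>; hence all
      \<open>U j\<close> with \<open>j \<le> k\<close> are covered by the maximum over times below
      \<open>k\<close>.\<close>
    define U where "U j = (\<Sum>\<tau><j. A \<tau> - lam)" for j
    define L where "L = norm lam"
    define \<epsilon> where "\<epsilon> = c\<^sub>0 * (1 + L + M)"
    have UM: "norm (U j) \<le> M" if "0 < j" "j \<le> k" for j
    proof -
      obtain i where i: "j = Suc i" using \<open>0 < j\<close> by (cases j) auto
      then have "norm (\<Sum>\<tau>\<le>i. A \<tau> - lam) \<le> M"
        using \<open>j \<le> k\<close> by (auto simp: M_def max_below_def intro!: Max_ge)
      then show ?thesis by (simp add: U_def i lessThan_Suc_atMost)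
    qed
    have "0 \<le> M"
    proof (cases "k = 0")
      case False
      then show ?thesis using UM[of k] norm_ge_zero order_trans by blast
    qed (simp add: M_def max_below_def)
    then have UM: "norm (U j) \<le> M" if "j \<le> k" for j
      using UM[of j] that by (cases "j = 0") (auto simp: U_def)
    have "0 \<le> L" by (simp add: L_def)
    have "0 < \<epsilon>"
      unfolding \<epsilon>_def using \<open>0 < c\<^sub>0\<close> \<open>0 \<le> L\<close> \<open>0 \<le> M\<close> by (intro mult_pos_pos) auto
    define c where "c = (\<lambda>k. \<epsilon>\<^sup>2 * \<gamma> k)"
    have gapc: "level_gap c \<epsilon> (drift_diffs R w S)"
      using gap[OF \<open>0 < \<epsilon>\<close>] by (simp add: c_def D_def)
    obtain \<mu> where \<mu>: "\<And>t. \<mu> t \<in> Sw R S w (Q t)"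
      and step: "\<And>t. Q (Suc t) = Q t + A t + (R - mat 1) *v vmin (\<mu> t) (Q t)"
      using Q unfolding wmw_process_def by blast
    \<comment> \<open>The curve starts at 0, because \<open>q 0 = Q 0\<close> and \<open>U 0\<close>
      is an empty sum.\<close>
    have "lyap c D (sqd w *v (Q j - U j - q (real j))) \<le> lyap c D 0" if "j \<le> k" for j
      using that
    proof (induction j)
      case 0
      then show ?case by (simp add: U_def q0)
    next
      case (Suc j)
      define u where "u = vmin (\<mu> j) (Q j)"
      have "\<mu> j \<in> S" using \<mu>[of j] by (simp add: Sw_def)
      have u: "u \<in> convex hull near_max R S w \<epsilon>\<^sub>0 (Q j)"
        unfolding u_def using wmw_process_nonneg[OF net _ Q] A \<mu> \<epsilon>\<^sub>0[OF \<open>\<mu> j \<in> S\<close>]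
        by (intro vmin_in_hull_near_max[OF net w]) auto
      have "norm (drift R w u) \<le> \<beta>"
        using u by (rule \<beta>_hull) (auto simp: near_max_def)
      have small: "- (\<epsilon> - \<epsilon>\<^sub>0) \<le> (sqd w *v (\<theta> *\<^sub>R lam - U j) - \<theta> *\<^sub>R drift R w u) \<bullet> d"
        if \<theta>: "0 \<le> \<theta>" "\<theta> \<le> 1" and d: "d \<in> drift_diffs R w S" for \<theta> d
      proof -
        define r where "r = sqd w *v (\<theta> *\<^sub>R lam - U j) - \<theta> *\<^sub>R drift R w u"
        have "norm r \<le> norm (sqd w *v (\<theta> *\<^sub>R lam - U j)) + norm (\<theta> *\<^sub>R drift R w u)"
          unfolding r_def by (rule norm_triangle_ineq4)
        also have "\<dots> \<le> KT * (L + M) + \<beta>"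
        proof (rule add_mono)
          have "norm (\<theta> *\<^sub>R lam - U j) \<le> norm (\<theta> *\<^sub>R lam) + norm (U j)"
            by (rule norm_triangle_ineq4)
          also have "\<dots> \<le> L + M"
            using \<theta> UM[of j] Suc.prems mult_left_le_one_le[of L \<theta>] \<open>0 \<le> L\<close>
            by (intro add_mono) (auto simp: L_def)
          finally show "norm (sqd w *v (\<theta> *\<^sub>R lam - U j)) \<le> KT * (L + M)"
            using KT[of "\<theta> *\<^sub>R lam - U j"] \<open>0 < KT\<close> by (meson less_imp_le mult_left_mono order_trans)
          show "norm (\<theta> *\<^sub>R drift R w u) \<le> \<beta>"
            using \<theta> mult_left_le_one_le[of "norm (drift R w u)" \<theta>] \<open>norm (drift R w u) \<le> \<beta>\<close> by simp
        qed
        finally have r: "norm r \<le> KT * (L + M) + \<beta>" .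
        have "\<bar>r \<bullet> d\<bar> \<le> norm r * norm d"
          by (rule Cauchy_Schwarz_ineq2)
        also have "\<dots> \<le> (KT * (L + M) + \<beta>) * (2 * \<beta>)"
          using r D_norm[of d] d order_trans[OF norm_ge_zero r] by (intro mult_mono) (auto simp: D_def)
        also have "\<dots> \<le> \<epsilon> - \<epsilon>\<^sub>0"
        proof -
          have "(2 * \<beta> * KT) * (L + M) \<le> c\<^sub>0 * (L + M)"
            using \<open>0 \<le> \<beta>\<close> \<open>0 \<le> \<epsilon>\<^sub>0\<close> \<open>0 \<le> L\<close> \<open>0 \<le> M\<close> by (intro mult_right_mono) (auto simp: c\<^sub>0_def)
          moreover have "\<epsilon>\<^sub>0 + 2 * \<beta> * \<beta> \<le> c\<^sub>0"
            using \<open>0 \<le> \<beta>\<close> \<open>0 < KT\<close> by (simp add: c\<^sub>0_def)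
          ultimately show ?thesis
            by (simp add: \<epsilon>_def algebra_simps)
        qed
        finally show ?thesis by (simp add: r_def)
      qed
      \<comment> \<open>Subtracting \<open>U\<close> replaces the actual arrivals by
        \<open>lam\<close> in each increment, so the end of one slot is the start of the
        next.\<close>
      have "Q j - U j + (lam - (mat 1 - R) *v u) = Q (Suc j) - U (Suc j)"
        by (simp add: step u_def U_def matrix_vector_mult_diff_rdistrib)
      then have "lyap c D (sqd w *v (Q (Suc j) - U (Suc j) - q (real (Suc j))))
          \<le> lyap c D (sqd w *v (Q j - U j - q (real j)))"
        using lyap_step[OF net w fl gapc _ u small, of "real j"] by (simp add: D_def add.commute)
      also have "\<dots> \<le> lyap c D 0"
        using Suc by simp
      finally show ?case .
    qed
    from this[of k] have "lyap c D (sqd w *v (Q k - U k - q (real k))) \<le> lyap c D 0" by simp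
    also have "\<dots> \<le> c (card D)"
      using \<open>mono \<gamma>\<close> by (intro lyap_0_le finD) (auto simp: mono_def c_def intro!: mult_left_mono)
    finally have "(norm (sqd w *v (Q k - U k - q (real k))))\<^sup>2 \<le> c (card D)"
      using norm_le_lyap[OF finD, of c "sqd w *v (Q k - U k - q (real k))"] \<open>\<gamma> 0 = 0\<close> by (simp add: c_def)
    then have "norm (sqd w *v (Q k - U k - q (real k))) \<le> sqrt (c (card D))"
      by (rule real_le_rsqrt)
    also have "\<dots> = \<epsilon> * sqrt (\<gamma> (card D))"
      using \<open>0 < \<epsilon>\<close> by (simp add: c_def real_sqrt_mult)
    finally have "norm (Q k - U k - q (real k)) \<le> KI * (\<epsilon> * sqrt (\<gamma> (card D)))"
      using KI[of "Q k - U k - q (real k)"] \<open>0 < KI\<close> by (meson less_imp_le mult_left_mono order_trans)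
    moreover have "norm (Q k - q (real k)) \<le> norm (Q k - U k - q (real k)) + norm (U k)"
      using norm_triangle_ineq[of "Q k - U k - q (real k)" "U k"] by simp
    moreover have "norm (U k) \<le> 1 + L + M"
      using UM[of k] \<open>0 \<le> L\<close> by simp
    ultimately have "norm (Q k - q (real k)) \<le> KI * (\<epsilon> * sqrt (\<gamma> (card D))) + (1 + L + M)"
      by linarith
    also have "\<dots> = (KI * c\<^sub>0 * sqrt (\<gamma> (card D)) + 1) * (1 + L + M)"
      by (simp add: \<epsilon>_def algebra_simps)
    finally show "norm (Q k - q (real k)) \<le> (KI * c\<^sub>0 * sqrt (\<gamma> (card D)) + 1) *
        (1 + norm lam + max_below k (\<lambda>t. norm (\<Sum>\<tau>\<le>t. A \<tau> - lam)))"
      by (simp only: L_def M_def)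
  qed
qed

end
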